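(* Let $n=1$, $1<p<\infty$, $\frac1p+\frac1q=1$, let $\rho$ be an admissible measure on $\mathbb{R}$, and let $F(x):=\rho((-\infty,x])$ for $x\in\mathbb{R}$. The function $$v(x)=-\int_{-\infty}^x|F(y)|^{q-2}F(y)\,dy,\quad x\in\mathbb{R},$$ is an extremal with $$[v]_\rho=\frac{\left|\int_{-\infty}^\infty v(y)\,d\rho(y)\right|}{\left|\int_{-\infty}^\infty y\,d\rho(y)\right|^{1-1/p}}.$$ Moreover, $$C_*=\frac{\left(\int_{-\infty}^\infty|F(y)|^q\,dy\right)^{1/q}}{\left|\int_{-\infty}^\infty y\,d\rho(y)\right|^{1/q}}.$$
   Context: $\mathcal{D}^{1,p}(\mathbb{R})$ is the space of $u\in L^1_{\rm loc}(\mathbb{R})$ whose weak derivative $u'$ belongs to $L^p(\mathbb{R})$; each $u$ is identified with its $(1-1/p)$-Hölder continuous representative. $\|u'\|_p:=\left(\int_{\mathbb{R}}|u'|^p\,dx\right)^{1/p}$. An admissible measure is a signed Borel measure $\rho$ on $\mathbb{R}$ with compact support, $\rho(\mathbb{R})=0$, and $\int_{\mathbb{R}}y\,d\rho(y)\ne 0$. The expression $|F|^{q-2}F$ is understood to be $0$ where $F=0$. $\mathcal{S}(1)$ is the set of similarity transformations $S(y)=\lambda Oy+z$ of $\mathbb{R}$ with $\lambda>0$, $O\in\mathrm{O}(1)=\{\pm1\}$, $z\in\mathbb{R}$. The push forward is $(S_\#\rho)(A)=\rho(S^{-1}(A))$ for Borel $A\subset\mathbb{R}$. For $u\in\mathcal{D}^{1,p}(\mathbb{R})$,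 $$[u]_\rho:=\sup\left\{\frac{\left|\int u\,d\mu\right|}{\left|\int x\,d\mu(x)\right|^{1-1/p}}:\ \mu=S_\#\rho,\ S\in\mathcal{S}(1)\right\}.$$ $C_*$ is the smallest constant $C$ such that the generalized Morrey inequality $[u]_\rho\le C\|u'\|_p$ holds for all $u\in\mathcal{D}^{1,p}(\mathbb{R})$. An extremal is a $u\in\mathcal{D}^{1,p}(\mathbb{R})$ with $[u]_\rho=C_*\|u'\|_p$. *)

theory Defs
  imports "HOL-Analysis.Analysis"
begin

section \<open>Signed Borel measures on the real line\<close>

text \<open>
  A signed measure is represented by its set function; values outside the Borel sets are irrelevant.
  Only finite signed measures are modelled. This loses nothing for admissible measures: a signed
  measure omits one of the values plus or minus infinity, so total mass 0 forces it to be finite.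
\<close>

definition signed_borel_measure :: "(real set \<Rightarrow> real) \<Rightarrow> bool" where
  "signed_borel_measure \<rho> \<longleftrightarrow>
     \<rho> {} = 0 \<and>
     (\<forall>A :: nat \<Rightarrow> real set. range A \<subseteq> sets borel \<longrightarrow> disjoint_family A \<longrightarrow>
        (\<lambda>i. \<rho> (A i)) sums \<rho> (\<Union>i. A i))"

text \<open>
  The Jordan decomposition: the upper variation of \<open>\<rho>\<close>, and the lower variation as the upper
  variation of \<open>-\<rho>\<close>. Negative values of \<open>\<rho> B\<close> are truncated to 0 by \<open>ennreal\<close>, which does not
  affect the supremum since \<open>B = {}\<close> is allowed.
\<close>

definition upper_variation :: "(real set \<Rightarrow> real) \<Rightarrow> real measure" where
  "upper_variation \<rho> =
     measure_of UNIV (sets borel) (\<lambda>A. SUP B\<in>{B \<in> sets borel. B \<subseteq> A}. ennreal (\<rho> B))"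

definition signed_integral :: "(real set \<Rightarrow> real) \<Rightarrow> (real \<Rightarrow> real) \<Rightarrow> real" where
  "signed_integral \<rho> f =
     (LINT x|upper_variation \<rho>. f x) - (LINT x|upper_variation (\<lambda>A. - \<rho> A). f x)"

definition compactly_supported :: "(real set \<Rightarrow> real) \<Rightarrow> bool" where
  "compactly_supported \<rho> \<longleftrightarrow>
     (\<exists>K. compact K \<and> (\<forall>A\<in>sets borel. A \<inter> K = {} \<longrightarrow> \<rho> A = 0))"

definition admissible :: "(real set \<Rightarrow> real) \<Rightarrow> bool" where
  "admissible \<rho> \<longleftrightarrow>
     signed_borel_measure \<rho> \<and> compactly_supported \<rho> \<and> \<rho> UNIV = 0 \<and>
     signed_integral \<rho> (\<lambda>y. y) \<noteq> 0"

definition push_forward :: "(real \<Rightarrow> real) \<Rightarrow> (real set \<Rightarrow> real) \<Rightarrow> real set \<Rightarrow> real" where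
  "push_forward S \<rho> = (\<lambda>A. \<rho> (S -` A))"

definition similarities :: "(real \<Rightarrow> real) set" where
  "similarities = {(\<lambda>y. s * (e * y) + z) | s e z. s > 0 \<and> e \<in> {1, -1}}"


section \<open>The space of functions with weak derivative in Lp\<close>

definition test_function :: "(real \<Rightarrow> real) \<Rightarrow> bool" where
  "test_function \<phi> \<longleftrightarrow>
     (\<forall>k x. (deriv ^^ k) \<phi> field_differentiable at x) \<and>
     (\<exists>K. compact K \<and> (\<forall>x. x \<notin> K \<longrightarrow> \<phi> x = 0))"

definition locally_integrable :: "(real \<Rightarrow> real) \<Rightarrow> bool" where
  "locally_integrable u \<longleftrightarrow> (\<forall>K. compact K \<longrightarrow> set_integrable lborel K u)"

definition has_weak_derivative :: "(real \<Rightarrow> real) \<Rightarrow> (real \<Rightarrow> real) \<Rightarrow> bool" where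
  "has_weak_derivative u g \<longleftrightarrow>
     locally_integrable u \<and> locally_integrable g \<and>
     (\<forall>\<phi>. test_function \<phi> \<longrightarrow>
        (LINT x|lborel. u x * deriv \<phi> x) = - (LINT x|lborel. g x * \<phi> x))"

text \<open>
  Elements of the space are the continuous representatives, so integrals against measures that are
  not absolutely continuous make sense.
\<close>

definition D1p :: "real \<Rightarrow> (real \<Rightarrow> real) set" where
  "D1p p = {u. continuous_on UNIV u \<and> locally_integrable u \<and>
     (\<exists>g. has_weak_derivative u g \<and> integrable lborel (\<lambda>x. \<bar>g x\<bar> powr p))}"

text \<open>The weak derivative is unique up to a null set, so the choice does not affect the norm.\<close>

definition weak_derivative :: "(real \<Rightarrow> real) \<Rightarrow> real \<Rightarrow> real" where
  "weak_derivative u = (SOME g. has_weak_derivative u g)"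

definition deriv_norm :: "real \<Rightarrow> (real \<Rightarrow> real) \<Rightarrow> real" where
  "deriv_norm p u = (LINT x|lborel. \<bar>weak_derivative u x\<bar> powr p) powr (1 / p)"


section \<open>The generalized Morrey inequality\<close>

text \<open>The supremum is taken in the extended reals, so its finiteness is not presupposed.\<close>

definition morrey_seminorm :: "real \<Rightarrow> (real set \<Rightarrow> real) \<Rightarrow> (real \<Rightarrow> real) \<Rightarrow> ereal" where
  "morrey_seminorm p \<rho> u =
     (SUP \<mu> \<in> (\<lambda>S. push_forward S \<rho>) ` similarities.
        ereal (\<bar>signed_integral \<mu> u\<bar> / \<bar>signed_integral \<mu> (\<lambda>x. x)\<bar> powr (1 - 1 / p)))"

definition morrey_inequality :: "real \<Rightarrow> (real set \<Rightarrow> real) \<Rightarrow> real \<Rightarrow> bool" where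
  "morrey_inequality p \<rho> C \<longleftrightarrow>
     (\<forall>u\<in>D1p p. morrey_seminorm p \<rho> u \<le> ereal (C * deriv_norm p u))"

definition smallest_morrey_constant :: "real \<Rightarrow> (real set \<Rightarrow> real) \<Rightarrow> real \<Rightarrow> bool" where
  "smallest_morrey_constant p \<rho> C \<longleftrightarrow>
     morrey_inequality p \<rho> C \<and> (\<forall>C'. morrey_inequality p \<rho> C' \<longrightarrow> C \<le> C')"

definition C_star :: "real \<Rightarrow> (real set \<Rightarrow> real) \<Rightarrow> real" where
  "C_star p \<rho> = (THE C. smallest_morrey_constant p \<rho> C)"

definition extremal :: "real \<Rightarrow> (real set \<Rightarrow> real) \<Rightarrow> (real \<Rightarrow> real) \<Rightarrow> bool" where
  "extremal p \<rho> u \<longleftrightarrow>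
     u \<in> D1p p \<and> morrey_seminorm p \<rho> u = ereal (C_star p \<rho> * deriv_norm p u)"

end

theory Submission imports Defs begin

text \<open>Since \<open>\<rho>\<close> has total mass 0, integration by parts gives \<open>\<integral>u d\<rho> = - \<integral>u' F\<close>, and the Hoelder
  inequality bounds this by the product of the \<open>p\<close>-norm of \<open>u'\<close> and the \<open>q\<close>-norm of \<open>F\<close>. For a
  push forward of \<open>\<rho>\<close> under \<open>S y = c y + d\<close> the same argument is applied to \<open>u \<circ> S\<close>; numerator and
  denominator of the Morrey quotient both pick up the factor \<open>\<bar>c\<bar>\<close> to the power \<open>1 - 1/p\<close>, so the
  bound does not depend on \<open>S\<close>. The derivative of \<open>v\<close> is the function that gives equality in the
  Hoelder inequality for \<open>S = id\<close>, which makes \<open>v\<close> an extremal and the constant sharp.\<close>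

subsection \<open>The Jordan decomposition\<close>

text \<open>The definitions are remote from the calculus that the estimate uses, and closing this
  gap shapes the proof. \<open>upper_variation\<close> is only a supremum of set values handed to
  \<open>measure_of\<close>, so countable additivity and finiteness must be established before
  \<open>signed_integral\<close> can be evaluated; both come directly from the countable additivity
  of \<open>\<rho>\<close>, without a Hahn decomposition. On the other side,
  \<open>weak_derivative\<close> is an unspecified choice, visible only through smooth test
  functions, while \<open>v\<close> is given by a Lebesgue integral. The predicate
  \<open>primitive\<close> mediates: a continuous \<open>u\<close> has weak derivative
  \<open>g\<close> exactly when \<open>primitive u g\<close>, and then \<open>g\<close> is
  determined almost everywhere. One Fubini argument on a triangle serves both the passage from
  \<open>primitive\<close> to weak derivatives and the integrals against \<open>\<rho>\<close>.
  Sharpness needs the norm of \<open>v\<close> to be positive; this follows from the nonzero first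
  moment, because that moment is minus the integral of \<open>F\<close>.\<close>

lemma signed_borel_measure_Un:
  assumes "signed_borel_measure \<rho>" "A \<in> sets borel" "B \<in> sets borel" "A \<inter> B = {}"
  shows "\<rho> (A \<union> B) = \<rho> A + \<rho> B"
proof -
  have "range (binaryset A B) \<subseteq> sets borel"
    using assms by (auto simp: binaryset_def)
  moreover have "disjoint_family (binaryset A B)"
    using assms by (auto simp: disjoint_family_on_def binaryset_def)
  ultimately have "(\<lambda>i. \<rho> (binaryset A B i)) sums \<rho> (\<Union>i. binaryset A B i)"
    using assms unfolding signed_borel_measure_def by blast
  moreover have "(\<lambda>i. \<rho> (binaryset A B i)) sums (\<rho> A + \<rho> B)"
    using assms by (intro binaryset_sums) (simp add: signed_borel_measure_def)
  ultimately show ?thesis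
    by (auto simp: UN_binaryset_eq dest: sums_unique2)
qed

lemma signed_borel_measure_Diff:
  assumes "signed_borel_measure \<rho>" "A \<in> sets borel" "B \<in> sets borel" "B \<subseteq> A"
  shows "\<rho> (A - B) = \<rho> A - \<rho> B"
proof -
  have "(A - B) \<union> B = A" using assms by auto
  then show ?thesis
    using signed_borel_measure_Un[of \<rho> "A - B" B] assms
    by (metis Diff_disjoint Int_commute add_diff_cancel_right' sets.Diff)
qed

lemma signed_borel_measure_uminus:
  "signed_borel_measure \<rho> \<Longrightarrow> signed_borel_measure (\<lambda>A. - \<rho> A)"
  unfolding signed_borel_measure_def by (auto intro: sums_minus)

text \<open>If \<open>\<rho>\<close> were unbounded, one could repeatedly split off a piece of mass at least 1 in absolute
  value from a set on which \<open>\<rho>\<close> is unbounded, contradicting countable additivity.\<close>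

lemma signed_borel_measure_bounded:
  assumes \<rho>: "signed_borel_measure \<rho>"
  obtains M where "\<And>B. B \<in> sets borel \<Longrightarrow> \<rho> B \<le> M"
proof -
  define unb where "unb E \<longleftrightarrow> E \<in> sets borel \<and> (\<forall>M. \<exists>B\<in>sets borel. B \<subseteq> E \<and> \<rho> B > M)" for E
  have step: "\<exists>E'. unb E' \<and> E' \<subseteq> E \<and> \<bar>\<rho> (E - E')\<bar> \<ge> 1" if E: "unb E" for E
  proof -
    \<comment> \<open>The margin \<open>\<bar>\<rho> E\<bar> + 1\<close> makes both halves heavy:
      \<open>\<rho> B\<close> exceeds 1, and \<open>\<rho> (E - B) = \<rho> E - \<rho> B\<close>
      lies below -1. Either half may therefore be split off, whichever leaves an unbounded
      remainder.\<close>
    obtain B where B: "B \<in> sets borel" "B \<subseteq> E" "\<rho> B > \<bar>\<rho> E\<bar> + 1"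
      using E unfolding unb_def by blast
    show ?thesis
    proof (cases "unb B")
      case True
      have "\<rho> (E - B) = \<rho> E - \<rho> B"
        using signed_borel_measure_Diff[OF \<rho> _ B(1,2)] E by (auto simp: unb_def)
      then show ?thesis
        using True B by (intro exI[of _ B]) auto
    next
      case False
      then obtain K where K: "\<And>C. C \<in> sets borel \<Longrightarrow> C \<subseteq> B \<Longrightarrow> \<rho> C \<le> K"
        using B unfolding unb_def by (meson not_le)
      \<comment> \<open>A subset of \<open>E\<close> with a large value owes at most
        \<open>K\<close> of it to its part inside \<open>B\<close>, so the excess survives in
        \<open>E - B\<close>.\<close>
      have "unb (E - B)" unfolding unb_def
      proof (intro conjI allI)
        show "E - B \<in> sets borel" using E B by (auto simp: unb_def)
        fix M
        obtain C where C: "C \<in> sets borel" "C \<subseteq> E" "\<rho> C > M + K"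
          using E unfolding unb_def by blast
        have "\<rho> (C - C \<inter> B) = \<rho> C - \<rho> (C \<inter> B)"
          using signed_borel_measure_Diff[OF \<rho> C(1), of "C \<inter> B"] B C by auto
        moreover have "\<rho> (C \<inter> B) \<le> K" using K[of "C \<inter> B"] B C by auto
        ultimately show "\<exists>D\<in>sets borel. D \<subseteq> E - B \<and> M < \<rho> D"
          using B C by (intro bexI[of _ "C - C \<inter> B"]) auto
      qed
      moreover have "E - (E - B) = B" using B by auto
      ultimately show ?thesis using B by (intro exI[of _ "E - B"]) auto
    qed
  qed
  have "\<not> unb UNIV"
  proof
    assume "unb UNIV"
    then obtain E where E: "\<And>n::nat. unb (E n)"
        "\<And>n. E (Suc n) \<subseteq> E n \<and> \<bar>\<rho> (E n - E (Suc n))\<bar> \<ge> 1"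
      using dependent_nat_choice[of "\<lambda>_ E. unb E" "\<lambda>_ E E'. E' \<subseteq> E \<and> \<bar>\<rho> (E - E')\<bar> \<ge> 1"] step by blast
    have dec: "E n \<subseteq> E m" if "m \<le> n" for m n
      using that by (rule lift_Suc_antimono_le[of E, rotated]) (use E(2) in auto)
    have "disjoint_family (\<lambda>n. E n - E (Suc n))"
      unfolding disjoint_family_on_def
    proof (intro ballI impI)
      fix m n :: nat assume "m \<noteq> n"
      then consider "Suc m \<le> n" | "Suc n \<le> m" by linarith
      then show "(E m - E (Suc m)) \<inter> (E n - E (Suc n)) = {}"
        by cases (use dec in blast)+
    qed
    moreover have "range (\<lambda>n. E n - E (Suc n)) \<subseteq> sets borel"
      using E(1) by (auto simp: unb_def)
    ultimately have "summable (\<lambda>n. \<rho> (E n - E (Suc n)))"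
      using \<rho> unfolding signed_borel_measure_def by (blast intro: sums_summable)
    then have "(\<lambda>n. \<rho> (E n - E (Suc n))) \<longlonglongrightarrow> 0" by (rule summable_LIMSEQ_zero)
    then have "\<forall>\<^sub>F n in sequentially. \<bar>\<rho> (E n - E (Suc n))\<bar> < 1"
      by (auto dest!: tendstoD[of _ _ _ 1])
    then obtain n where "\<bar>\<rho> (E n - E (Suc n))\<bar> < 1"
      by (auto simp: eventually_sequentially)
    with E(2)[of n] show False by auto
  qed
  then show ?thesis
    using that unfolding unb_def by (auto simp: not_less)
qed

section \<open>The upper variation as a finite Borel measure\<close>

lemma space_upper_variation [simp]: "space (upper_variation \<rho>) = UNIV"
  by (simp add: upper_variation_def)

lemma sets_upper_variation [simp, measurable_cong]: "sets (upper_variation \<rho>) = sets borel"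
proof -
  have "sigma_sets UNIV (sets (borel :: real measure)) = sets borel"
    using sets.sigma_sets_eq[of "borel :: real measure"] by simp
  then show ?thesis by (simp add: upper_variation_def)
qed

text \<open>\<open>measure_of\<close> returns the supremum only if the supremum is a measure.
  Superadditivity comes from uniting subsets of disjoint sets, countable subadditivity from cutting
  a subset of the union along the \<open>A i\<close>.\<close>

lemma emeasure_upper_variation:
  assumes \<rho>: "signed_borel_measure \<rho>" and A: "A \<in> sets borel"
  shows "emeasure (upper_variation \<rho>) A = (SUP B\<in>{B \<in> sets borel. B \<subseteq> A}. ennreal (\<rho> B))"
proof -
  define U where "U A = (SUP B\<in>{B \<in> sets borel. B \<subseteq> A}. ennreal (\<rho> B))" for A
  have U_ge: "ennreal (\<rho> B) \<le> U A" if "B \<in> sets borel" "B \<subseteq> A" for A B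
    using that unfolding U_def by (intro SUP_upper) auto
  have U_least: "U A \<le> c" if "\<And>B. B \<in> sets borel \<Longrightarrow> B \<subseteq> A \<Longrightarrow> ennreal (\<rho> B) \<le> c" for A c
    using that unfolding U_def by (intro SUP_least) auto
  have zero: "\<rho> {} = 0" using \<rho> by (simp add: signed_borel_measure_def)
  have pos: "positive (sets (upper_variation \<rho>)) U"
    using U_least[of "{}" 0] by (auto simp: positive_def zero)
  have super: "U A + U B \<le> U (A \<union> B)" if "A \<inter> B = {}" for A B
  proof -
    have *: "ennreal (\<rho> C) + ennreal (\<rho> D) \<le> U (A \<union> B)"
      if "C \<in> sets borel" "C \<subseteq> A" "D \<in> sets borel" "D \<subseteq> B" for C D
    proof -
      have un: "\<rho> (C \<union> D) = \<rho> C + \<rho> D"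
        using that \<open>A \<inter> B = {}\<close> by (intro signed_borel_measure_Un[OF \<rho>]) auto
      \<comment> \<open>A piece of negative value counts as 0 after truncation, so it is dropped
        rather than united with the other one, where it would lower the value.\<close>
      consider "\<rho> C \<le> 0" | "\<rho> D \<le> 0" | "\<rho> C \<ge> 0" "\<rho> D \<ge> 0" by linarith
      then show ?thesis
      proof cases
        case 1
        then show ?thesis using U_ge[of D "A \<union> B"] that by (auto simp: ennreal_neg)
      next
        case 2
        then show ?thesis using U_ge[of C "A \<union> B"] that by (auto simp: ennreal_neg)
      next
        case 3
        then show ?thesis
          using U_ge[of "C \<union> D" "A \<union> B"] that un by (auto simp: ennreal_plus[symmetric] simp del: ennreal_plus)
      qed
    qed
    have "U A + U B = (SUP C\<in>{B \<in> sets borel. B \<subseteq> A}. ennreal (\<rho> C) + U B)"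
      unfolding U_def by (subst ennreal_SUP_add_left) auto
    also have "\<dots> = (SUP C\<in>{B \<in> sets borel. B \<subseteq> A}. SUP D\<in>{D \<in> sets borel. D \<subseteq> B}.
        ennreal (\<rho> C) + ennreal (\<rho> D))"
      unfolding U_def by (intro SUP_cong refl, subst ennreal_SUP_add_right) auto
    also have "\<dots> \<le> U (A \<union> B)" using * by (intro SUP_least) auto
    finally show ?thesis .
  qed
  have "countably_additive (sets (upper_variation \<rho>)) U"
    unfolding countably_additive_def
  proof (intro allI impI)
    fix A :: "nat \<Rightarrow> real set"
    assume A: "range A \<subseteq> sets (upper_variation \<rho>)" and disj: "disjoint_family A"
    have "(\<Sum>i. U (A i)) \<le> U (\<Union>i. A i)"
    proof (rule suminf_le_const)
      fix n
      have "(\<Sum>i<n. U (A i)) \<le> U (\<Union>i<n. A i)"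
      proof (induction n)
        case (Suc n)
        have "A i \<inter> A n = {}" if "i < n" for i
          using disj that by (simp add: disjoint_family_on_def)
        then have "(\<Union>i<n. A i) \<inter> A n = {}" by blast
        then have "U (\<Union>i<n. A i) + U (A n) \<le> U ((\<Union>i<n. A i) \<union> A n)" by (rule super)
        also have "(\<Union>i<n. A i) \<union> A n = (\<Union>i<Suc n. A i)" by (auto simp: lessThan_Suc)
        finally show ?case
          using add_right_mono[OF Suc, of "U (A n)"] unfolding sum.lessThan_Suc by (rule order_trans[rotated])
      qed simp
      also have "\<dots> \<le> U (\<Union>i. A i)" by (intro U_least U_ge) auto
      finally show "(\<Sum>i<n. U (A i)) \<le> U (\<Union>i. A i)" .
    qed (rule summableI)
    moreover have "U (\<Union>i. A i) \<le> (\<Sum>i. U (A i))"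
    proof (rule U_least)
      fix B :: "real set" assume B: "B \<in> sets borel" "B \<subseteq> (\<Union>i. A i)"
      have "(\<lambda>i. \<rho> (A i \<inter> B)) sums \<rho> (\<Union>i. A i \<inter> B)"
      proof -
        have "range (\<lambda>i. A i \<inter> B) \<subseteq> sets borel" "disjoint_family (\<lambda>i. A i \<inter> B)"
          using A B by (auto intro: disjoint_family_on_bisimulation[OF disj])
        then show ?thesis using \<rho> unfolding signed_borel_measure_def by blast
      qed
      moreover have "(\<Union>i. A i \<inter> B) = B" using B by auto
      ultimately have lim: "(\<lambda>n. ennreal (\<Sum>i<n. \<rho> (A i \<inter> B))) \<longlonglongrightarrow> ennreal (\<rho> B)"
        by (auto simp: sums_def intro: tendsto_ennrealI)
      show "ennreal (\<rho> B) \<le> (\<Sum>i. U (A i))"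
      proof (rule LIMSEQ_le_const2[OF lim], intro exI allI impI)
        fix n
        \<comment> \<open>The real series may have negative terms, so each is replaced by its
          positive part before the sum is moved into \<open>ennreal\<close>.\<close>
        have "ennreal (\<Sum>i<n. \<rho> (A i \<inter> B)) \<le> ennreal (\<Sum>i<n. max 0 (\<rho> (A i \<inter> B)))"
          by (intro ennreal_leI sum_mono) auto
        also have "\<dots> = (\<Sum>i<n. ennreal (\<rho> (A i \<inter> B)))"
          by (subst sum_ennreal[symmetric]) (auto simp: ennreal_max_0)
        also have "\<dots> \<le> (\<Sum>i<n. U (A i))"
          using A B by (intro sum_mono U_ge) (auto simp: image_subset_iff)
        also have "\<dots> \<le> (\<Sum>i. U (A i))" by (intro sum_le_suminf summableI) auto
        finally show "ennreal (\<Sum>i<n. \<rho> (A i \<inter> B)) \<le> (\<Sum>i. U (A i))" .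
      qed
    qed
    ultimately show "(\<Sum>i. U (A i)) = U (\<Union>i. A i)" by (rule antisym)
  qed
  then have "emeasure (upper_variation \<rho>) A = U A"
    using A pos by (intro emeasure_measure_of[of _ UNIV "sets borel" U])
      (auto simp: U_def[abs_def] upper_variation_def)
  then show ?thesis by (simp add: U_def)
qed

lemma finite_measure_upper_variation:
  assumes \<rho>: "signed_borel_measure \<rho>"
  shows "finite_measure (upper_variation \<rho>)"
proof -
  obtain M where "\<And>B. B \<in> sets borel \<Longrightarrow> \<rho> B \<le> M"
    using signed_borel_measure_bounded[OF \<rho>] by blast
  then have "emeasure (upper_variation \<rho>) UNIV \<le> ennreal M"
    by (auto simp: emeasure_upper_variation[OF \<rho>] intro!: SUP_least ennreal_leI)
  then show ?thesis by (intro finite_measureI) (auto simp: top_unique)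
qed

text \<open>Within \<open>A\<close>, passing from \<open>B\<close> to \<open>A - B\<close> turns
  \<open>- \<rho> B\<close> into \<open>\<rho> (A - B) - \<rho> A\<close>, so the two suprema differ
  by \<open>\<rho> A\<close>. Only one inequality is proved; the other is the same statement for
  \<open>- \<rho>\<close>.\<close>

lemma Jordan_decomposition:
  assumes \<rho>: "signed_borel_measure \<rho>" and A: "A \<in> sets borel"
  shows "\<rho> A = measure (upper_variation \<rho>) A - measure (upper_variation (\<lambda>A. - \<rho> A)) A"
proof -
  have "measure (upper_variation \<rho>) A \<ge> measure (upper_variation (\<lambda>A. - \<rho> A)) A + \<rho> A"
    if \<rho>: "signed_borel_measure \<rho>" for \<rho>
  proof -
    interpret P: finite_measure "upper_variation \<rho>"
      by (rule finite_measure_upper_variation[OF \<rho>])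
    have "emeasure (upper_variation (\<lambda>A. - \<rho> A)) A
        \<le> ennreal (measure (upper_variation \<rho>) A - \<rho> A)"
      unfolding emeasure_upper_variation[OF signed_borel_measure_uminus[OF \<rho>] A]
    proof (intro SUP_least ennreal_leI, clarify)
      fix B assume B: "B \<in> sets borel" "B \<subseteq> A"
      have "ennreal (\<rho> (A - B)) \<le> emeasure (upper_variation \<rho>) A"
        unfolding emeasure_upper_variation[OF \<rho> A] using A B by (intro SUP_upper) auto
      then have "\<rho> (A - B) \<le> measure (upper_variation \<rho>) A"
        by (simp add: P.emeasure_eq_measure)
      then show "- \<rho> B \<le> measure (upper_variation \<rho>) A - \<rho> A"
        using signed_borel_measure_Diff[OF \<rho> A B] by simp
    qed
    moreover have "measure (upper_variation \<rho>) A - \<rho> A \<ge> 0"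
    proof -
      have "ennreal (\<rho> A) \<le> emeasure (upper_variation \<rho>) A"
        unfolding emeasure_upper_variation[OF \<rho> A] using A by (intro SUP_upper) auto
      then show ?thesis by (simp add: P.emeasure_eq_measure)
    qed
    ultimately have "measure (upper_variation (\<lambda>A. - \<rho> A)) A \<le> measure (upper_variation \<rho>) A - \<rho> A"
      unfolding measure_def[of "upper_variation (\<lambda>A. - \<rho> A)"]
      by (simp add: enn2real_leI)
    then show ?thesis by simp
  qed
  from this[OF \<rho>] this[OF signed_borel_measure_uminus[OF \<rho>]] show ?thesis by simp
qed

text \<open>Transfers the support condition from \<open>\<rho>\<close> to its variations. All Borel
  subsets have to be considered, since \<open>\<rho> A = 0\<close> alone could be due to
  cancellation.\<close>

lemma null_sets_upper_variation:
  assumes \<rho>: "signed_borel_measure \<rho>" and A: "A \<in> sets borel"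
    and null: "\<And>B. B \<in> sets borel \<Longrightarrow> B \<subseteq> A \<Longrightarrow> \<rho> B = 0"
  shows "A \<in> null_sets (upper_variation \<rho>)"
proof -
  have "emeasure (upper_variation \<rho>) A = 0"
    unfolding emeasure_upper_variation[OF \<rho> A] bot_ennreal[symmetric]
    by (rule SUP_eq_const) (auto simp: null bot_ennreal)
  then show ?thesis using A by auto
qed

section \<open>Variations and integrals under push forward\<close>

lemma upper_variation_push_forward:
  assumes \<rho>: "signed_borel_measure \<rho>"
    and S: "S \<in> borel_measurable borel" "T \<in> borel_measurable borel"
    and inv: "\<And>x. T (S x) = x" "\<And>x. S (T x) = x"
  shows "upper_variation (push_forward S \<rho>) = distr (upper_variation \<rho>) borel S"
proof -
  have vimage: "S -` A \<in> sets borel" "T -` A \<in> sets borel" if "A \<in> sets borel" for A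
    using that S[THEN measurable_sets, of A] by auto
  have \<mu>: "signed_borel_measure (push_forward S \<rho>)"
    unfolding signed_borel_measure_def
  proof (intro conjI allI impI)
    show "push_forward S \<rho> {} = 0"
      using \<rho> by (simp add: push_forward_def signed_borel_measure_def)
    fix A :: "nat \<Rightarrow> real set" assume "range A \<subseteq> sets borel" "disjoint_family A"
    then have "range (\<lambda>i. S -` A i) \<subseteq> sets borel" "disjoint_family (\<lambda>i. S -` A i)"
      using vimage(1) by (auto simp: disjoint_family_on_def image_subset_iff)
    then have "(\<lambda>i. \<rho> (S -` A i)) sums \<rho> (\<Union>i. S -` A i)"
      using \<rho> unfolding signed_borel_measure_def by blast
    then show "(\<lambda>i. push_forward S \<rho> (A i)) sums push_forward S \<rho> (\<Union>i. A i)"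
      by (simp add: push_forward_def vimage_UN)
  qed
  show ?thesis
  proof (rule measure_eqI)
    fix A assume "A \<in> sets (upper_variation (push_forward S \<rho>))"
    then have A: "A \<in> sets borel" by simp
    \<comment> \<open>Invertibility of \<open>S\<close> is essential: every Borel subset of the
      preimage is itself a preimage. For a map that is not injective, cancellation could make the
      variation of the push forward strictly smaller.\<close>
    have "(\<lambda>B. S -` B) ` {B \<in> sets borel. B \<subseteq> A} = {B \<in> sets borel. B \<subseteq> S -` A}"
    proof (intro antisym subsetI)
      fix B assume "B \<in> {B \<in> sets borel. B \<subseteq> S -` A}"
      then have "T -` B \<in> {B \<in> sets borel. B \<subseteq> A}" "B = S -` (T -` B)"
        using inv vimage(2) by auto
      then show "B \<in> (\<lambda>B. S -` B) ` {B \<in> sets borel. B \<subseteq> A}" by blast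
    qed (auto intro: vimage(1))
    then have "(SUP B\<in>{B \<in> sets borel. B \<subseteq> S -` A}. ennreal (\<rho> B))
        = (SUP B\<in>(\<lambda>B. S -` B) ` {B \<in> sets borel. B \<subseteq> A}. ennreal (\<rho> B))"
      by (simp only:)
    also have "\<dots> = (SUP B\<in>{B \<in> sets borel. B \<subseteq> A}. ennreal (push_forward S \<rho> B))"
      by (simp only: push_forward_def image_image)
    finally have "emeasure (upper_variation (push_forward S \<rho>)) A = emeasure (upper_variation \<rho>) (S -` A)"
      unfolding emeasure_upper_variation[OF \<mu> A] emeasure_upper_variation[OF \<rho> vimage(1)[OF A]]
      by (rule sym)
    also have "\<dots> = emeasure (distr (upper_variation \<rho>) borel S) A"
      using A S by (subst emeasure_distr) (auto simp: measurable_cong_sets[OF sets_upper_variation])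
    finally show "emeasure (upper_variation (push_forward S \<rho>)) A
      = emeasure (distr (upper_variation \<rho>) borel S) A" .
  qed simp
qed

lemma signed_integral_push_forward:
  assumes \<rho>: "signed_borel_measure \<rho>"
    and S: "S \<in> borel_measurable borel" "T \<in> borel_measurable borel"
    and inv: "\<And>x. T (S x) = x" "\<And>x. S (T x) = x"
    and f: "f \<in> borel_measurable borel"
  shows "signed_integral (push_forward S \<rho>) f = signed_integral \<rho> (\<lambda>x. f (S x))"
proof -
  have "(LINT x|upper_variation (push_forward S \<rho>). f x) = (LINT x|upper_variation \<rho>. f (S x))"
    if "signed_borel_measure \<rho>" for \<rho>
    unfolding upper_variation_push_forward[OF that S inv]
    using S f by (intro integral_distr) (auto simp: measurable_cong_sets[OF sets_upper_variation])
  from this[OF \<rho>] this[OF signed_borel_measure_uminus[OF \<rho>]]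
  show ?thesis by (simp add: signed_integral_def push_forward_def)
qed

subsection \<open>A smooth step function\<close>

text \<open>The witness lists all derivatives at once, so closure properties are shown by writing
  down the new list instead of reasoning about iterated \<open>deriv\<close>.\<close>

definition smooth :: "(real \<Rightarrow> real) \<Rightarrow> bool" where
  "smooth f \<longleftrightarrow> (\<exists>D. D 0 = f \<and> (\<forall>k::nat. \<forall>x. (D k has_real_derivative D (Suc k) x) (at x)))"

lemma smooth_imp_field_differentiable:
  assumes "smooth f"
  shows "(deriv ^^ k) f field_differentiable at x"
proof -
  obtain D where D: "D 0 = f" "\<And>k x. (D k has_real_derivative D (Suc k) x) (at x)"
    using assms unfolding smooth_def by blast
  have "(deriv ^^ k) f = D k"
  proof (induction k)
    case (Suc k)
    then show ?case using DERIV_imp_deriv[OF D(2)] by auto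
  qed (simp add: D)
  then show ?thesis using D(2) field_differentiable_def by metis
qed

lemma smooth_antiderivative:
  assumes "\<And>x. (f has_real_derivative f' x) (at x)" "smooth f'"
  shows "smooth f"
proof -
  obtain D where D: "D 0 = f'" "\<And>k x. (D k has_real_derivative D (Suc k) x) (at x)"
    using assms(2) unfolding smooth_def by blast
  show ?thesis unfolding smooth_def
    by (rule exI[of _ "case_nat f D"]) (auto simp: assms(1) D split: nat.split)
qed

lemma smooth_affine:
  assumes "smooth f"
  shows "smooth (\<lambda>x. f (c * (x - d)))"
proof -
  obtain D where D: "D 0 = f" "\<And>k x. (D k has_real_derivative D (Suc k) x) (at x)"
    using assms unfolding smooth_def by blast
  have "((\<lambda>x. c ^ k * D k (c * (x - d))) has_real_derivative c ^ Suc k * D (Suc k) (c * (x - d))) (at x)"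
    for k x
    by (rule derivative_eq_intros DERIV_chain2[OF D(2)] refl | simp)+
  then show ?thesis unfolding smooth_def
    by (intro exI[of _ "\<lambda>k x. c ^ k * D k (c * (x - d))"]) (auto simp: D(1))
qed

lemma smooth_diff:
  assumes "smooth f" "smooth g"
  shows "smooth (\<lambda>x. f x - g x)"
proof -
  obtain D where D: "D 0 = f" "\<And>k x. (D k has_real_derivative D (Suc k) x) (at x)"
    using assms unfolding smooth_def by blast
  obtain E where E: "E 0 = g" "\<And>k x. (E k has_real_derivative E (Suc k) x) (at x)"
    using assms unfolding smooth_def by blast
  show ?thesis unfolding smooth_def
    by (rule exI[of _ "\<lambda>k x. D k x - E k x"]) (auto intro!: DERIV_diff D(2) E(2) simp: D(1) E(1))
qed

text \<open>The powers of \<open>w = x (1 - x)\<close> in the denominator make this family closed under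
  differentiation.\<close>

definition bump :: "real poly \<Rightarrow> nat \<Rightarrow> real \<Rightarrow> real" where
  "bump P m x = (if 0 < x \<and> x < 1
     then poly P x / (x * (1 - x)) ^ m * exp (- 1 / (x * (1 - x))) else 0)"

text \<open>One term of the exponential series already bounds \<open>exp (1 / w)\<close> from below.
  Since \<open>k\<close> is arbitrary, the decay at 0 beats any pole.\<close>

lemma exp_minus_inverse_le:
  fixes w :: real
  assumes "w > 0"
  shows "exp (- 1 / w) \<le> fact k * w ^ k"
proof -
  have "(1 / w) ^ k / fact k \<le> exp (1 / w)"
  proof -
    have "(\<lambda>n. (1 / w) ^ n / fact n) sums exp (1 / w)"
      using exp_converges[of "1 / w"] by (simp add: field_simps)
    then have "(\<Sum>n\<in>{k}. (1 / w) ^ n / fact n) \<le> exp (1 / w)"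
      using assms sum_le_suminf[of "\<lambda>n. (1 / w) ^ n / fact n" "{k}"]
      by (simp add: sums_iff)
    then show ?thesis by simp
  qed
  then have "1 \<le> exp (1 / w) * (fact k * w ^ k)"
    using assms by (simp add: field_simps)
  then show ?thesis
    using assms by (simp add: exp_minus field_simps)
qed

text \<open>A point \<open>x\<close> outside the open unit interval lies beyond one of its
  endpoints, hence \<open>y * (1 - y) \<le> \<bar>y - x\<bar>\<close>. The exponential bound is used
  with exponent \<open>m + 2\<close>: \<open>m\<close> factors cancel the pole and two remain for
  the square.\<close>

lemma bump_bound:
  obtains M where "\<And>x y. \<not> (0 < x \<and> x < 1) \<Longrightarrow> \<bar>bump P m y\<bar> \<le> M * (y - x)\<^sup>2"
proof -
  have "compact (poly P ` {0..1})"
    by (intro compact_continuous_image continuous_intros) auto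
  then obtain B where B: "\<And>y. y \<in> {0..1} \<Longrightarrow> \<bar>poly P y\<bar> \<le> B"
    using compact_imp_bounded bounded_iff by (metis imageI real_norm_def)
  have B0: "B \<ge> 0" using B[of 0] by auto
  have "\<bar>bump P m y\<bar> \<le> B * fact (m + 2) * (y - x)\<^sup>2" if x: "\<not> (0 < x \<and> x < 1)" for x y
  proof (cases "0 < y \<and> y < 1")
    case True
    define w where "w = y * (1 - y)"
    have w: "w > 0" using True by (simp add: w_def)
    have "w \<le> \<bar>y - x\<bar>"
    proof (cases "x \<le> 0")
      case x: True
      have "w \<le> y * 1" unfolding w_def using True by (intro mult_left_mono) auto
      then show ?thesis using x True by auto
    next
      case False
      have "w \<le> 1 * (1 - y)" unfolding w_def using True by (intro mult_right_mono) auto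
      then show ?thesis using x False True by auto
    qed
    then have w2: "w\<^sup>2 \<le> (y - x)\<^sup>2" using w by (metis abs_of_pos abs_le_square_iff)
    have "\<bar>bump P m y\<bar> = \<bar>poly P y\<bar> / w ^ m * exp (- 1 / w)"
      using True w by (simp add: bump_def w_def abs_mult)
    also have "\<dots> \<le> B / w ^ m * (fact (m + 2) * w ^ (m + 2))"
      using True w B0 B[of y] by (intro mult_mono divide_right_mono exp_minus_inverse_le) auto
    also have "\<dots> = B * fact (m + 2) * w\<^sup>2"
      using w by (simp add: power_add power2_eq_square del: fact_Suc add_2_eq_Suc')
    also have "\<dots> \<le> B * fact (m + 2) * (y - x)\<^sup>2"
      using B0 w2 by (intro mult_left_mono) auto
    finally show ?thesis .
  next
    case False
    then have "bump P m y = 0" by (auto simp: bump_def)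
    then show ?thesis using B0 by simp
  qed
  then show ?thesis using that by blast
qed

text \<open>Here \<open>W\<close> is the polynomial \<open>w = x (1 - x)\<close> and
  \<open>W'\<close> its derivative. Differentiating the power contributes denominator
  \<open>w ^ (m + 1)\<close> and differentiating the exponential \<open>w ^ (m + 2)\<close>; the new
  polynomial is the numerator over the latter.\<close>

lemma bump_has_derivative:
  defines "W \<equiv> [:0, 1, - 1:] :: real poly"
  defines "W' \<equiv> [:1, - 2:] :: real poly"
  shows "(bump P m has_real_derivative
    bump (pderiv P * W\<^sup>2 - smult (real m) (P * W' * W) + P * W') (m + 2) x) (at x)"
    (is "(_ has_real_derivative bump ?Q _ x) _")
proof (cases "0 < x \<and> x < 1")
  case True
  let ?w = "\<lambda>x::real. x * (1 - x)"
  have w: "?w x > 0" using True by simp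
  have "((\<lambda>x. poly P x / ?w x ^ m * exp (- 1 / ?w x)) has_real_derivative
      (poly (pderiv P) x / ?w x ^ m - real m * poly P x * (1 - 2 * x) / ?w x ^ (m + 1)
       + poly P x * (1 - 2 * x) / ?w x ^ (m + 2)) * exp (- 1 / ?w x)) (at x)"
  proof -
    have dw: "(?w has_real_derivative (1 - 2 * x)) (at x)"
      by (auto intro!: derivative_eq_intros)
    have pw: "((\<lambda>x. ?w x ^ m) has_real_derivative real m * ?w x ^ (m - 1) * (1 - 2 * x)) (at x)"
      using DERIV_power[OF dw, of m] by (simp add: ac_simps)
    have p: "((\<lambda>x. poly P x / ?w x ^ m) has_real_derivative
        (poly (pderiv P) x * ?w x ^ m - poly P x * (real m * ?w x ^ (m - 1) * (1 - 2 * x)))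
        / (?w x ^ m * ?w x ^ m)) (at x)"
      using w by (intro DERIV_divide poly_DERIV pw) auto
    have e: "((\<lambda>x. exp (- 1 / ?w x)) has_real_derivative
        exp (- 1 / ?w x) * ((0 * ?w x - (- 1) * (1 - 2 * x)) / (?w x * ?w x))) (at x)"
      using w by (intro DERIV_chain2[OF DERIV_exp] DERIV_divide DERIV_const dw) auto
    have "(poly (pderiv P) x * ?w x ^ m - poly P x * (real m * ?w x ^ (m - 1) * (1 - 2 * x)))
        / (?w x ^ m * ?w x ^ m) * exp (- 1 / ?w x)
      + exp (- 1 / ?w x) * ((0 * ?w x - (- 1) * (1 - 2 * x)) / (?w x * ?w x)) * (poly P x / ?w x ^ m)
      = (poly (pderiv P) x / ?w x ^ m - real m * poly P x * (1 - 2 * x) / ?w x ^ (m + 1)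
       + poly P x * (1 - 2 * x) / ?w x ^ (m + 2)) * exp (- 1 / ?w x)"
    proof -
      have "(a * w ^ m - b * (real m * w ^ (m - 1) * d)) / (w ^ m * w ^ m) * e
          + e * ((0 * w - (- 1) * d) / (w * w)) * (b / w ^ m)
        = (a / w ^ m - real m * b * d / w ^ (m + 1) + b * d / w ^ (m + 2)) * e"
        if "w > 0" for a b d e w :: real
      \<comment> \<open>For \<open>m = 0\<close> the exponent \<open>m - 1\<close> is truncated to
        0, which does no harm because of the factor \<open>real m\<close>.\<close>
      proof (cases m)
        case 0
        then show ?thesis using that by (simp add: field_simps)
      next
        case (Suc n)
        have "w ^ n > 0" using that by simp
        then show ?thesis using that unfolding Suc
          by (simp add: divide_simps del: of_nat_Suc) (simp add: algebra_simps)
      qed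
      then show ?thesis using w by blast
    qed
    with DERIV_mult[OF p e] show ?thesis by (simp only:)
  qed
  also have "(poly (pderiv P) x / ?w x ^ m - real m * poly P x * (1 - 2 * x) / ?w x ^ (m + 1)
       + poly P x * (1 - 2 * x) / ?w x ^ (m + 2)) * exp (- 1 / ?w x) = bump ?Q (m + 2) x"
  proof -
    have W: "poly W x = ?w x" "poly W' x = 1 - 2 * x" by (simp_all add: W_def W'_def algebra_simps)
    have alg: "(a / w ^ m - r * b * d / w ^ (m + 1) + b * d / w ^ (m + 2)) * e
        = (a * w\<^sup>2 - r * (b * d * w) + b * d) / w ^ (m + 2) * e" if "w > 0" for a b d e r w :: real
      using that by (simp add: field_simps power2_eq_square)
    show ?thesis using True unfolding alg[OF w] by (simp add: bump_def W poly_power)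
  qed
  finally show ?thesis
    by (rule has_field_derivative_transform_within_open[of _ _ _ "{0<..<1}"])
       (use True in \<open>auto simp: bump_def\<close>)
next
  case False
  \<comment> \<open>No single formula is valid around the endpoints. The quadratic bound squeezes
    the difference quotient to 0 there, and at all exterior points as well.\<close>
  obtain M where M: "\<And>y. \<bar>bump P m y\<bar> \<le> M * (y - x)\<^sup>2"
    using bump_bound[of P m] False by metis
  have "bump P m x = 0" "bump ?Q (m + 2) x = 0" using False by (auto simp: bump_def)
  moreover have "((\<lambda>y. bump P m y / (y - x)) \<longlongrightarrow> 0) (at x)"
  proof (rule Lim_null_comparison)
    show "\<forall>\<^sub>F y in at x. norm (bump P m y / (y - x)) \<le> M * \<bar>y - x\<bar>"
      unfolding eventually_at_filter
    proof (intro always_eventually allI impI)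
      fix y assume "y \<noteq> x"
      then have "\<bar>bump P m y\<bar> / \<bar>y - x\<bar> \<le> M * \<bar>y - x\<bar>"
        using M[of y] by (simp add: divide_le_eq mult.assoc power2_eq_square flip: abs_mult)
      then show "norm (bump P m y / (y - x)) \<le> M * \<bar>y - x\<bar>" by simp
    qed
    show "((\<lambda>y. M * \<bar>y - x\<bar>) \<longlongrightarrow> 0) (at x)" 
      by (auto intro!: tendsto_eq_intros)
  qed
  ultimately show ?thesis by (simp add: has_field_derivative_iff)
qed

text \<open>The derivative rule yields a map \<open>s\<close> on codes \<open>(P, m)\<close>;
  iterating it produces the list of all derivatives.\<close>

lemma smooth_bump: "smooth (bump P m)"
proof -
  have "\<exists>c'. \<forall>x. (bump (fst c) (snd c) has_real_derivative bump (fst c') (snd c') x) (at x)" for c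
    using bump_has_derivative[of "fst c" "snd c"] by (metis fst_conv snd_conv)
  then obtain s where s: "\<And>c x. (bump (fst c) (snd c) has_real_derivative
      bump (fst (s c)) (snd (s c)) x) (at x)"
    by metis
  show ?thesis unfolding smooth_def
    by (rule exI[of _ "\<lambda>k. bump (fst ((s ^^ k) (P, m))) (snd ((s ^^ k) (P, m)))"]) (auto simp: s)
qed

text \<open>A normalised antiderivative of a bump. Differences of rescaled copies of
  \<open>\<Psi>\<close> approximate indicators of intervals, and their derivatives, rescaled copies
  of \<open>\<psi>\<close>, concentrate at the endpoints.\<close>

lemma smooth_step:
  obtains \<Psi> \<psi> :: "real \<Rightarrow> real"
  where "smooth \<Psi>" "\<And>x. (\<Psi> has_real_derivative \<psi> x) (at x)" "continuous_on UNIV \<psi>"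
    "\<And>x. x \<le> 0 \<Longrightarrow> \<Psi> x = 0" "\<And>x. x \<ge> 1 \<Longrightarrow> \<Psi> x = 1" "\<And>x. \<Psi> x \<in> {0..1}"
    "\<And>x. x \<notin> {0..1} \<Longrightarrow> \<psi> x = 0" "\<And>x. \<psi> x \<ge> 0"
proof -
  have cont: "isCont (bump P 0) x" for P x
    using bump_has_derivative DERIV_isCont by blast
  obtain G where "\<And>x. (G has_vector_derivative bump 1 0 x) (at x)"
    using einterval_antiderivative[of "- \<infinity>" \<infinity> "bump 1 0"] cont by auto
  then have G: "(G has_real_derivative bump 1 0 x) (at x)" for x
    by (simp add: has_real_derivative_iff_has_vector_derivative)
  have G01: "G 0 < G 1"
    by (rule DERIV_pos_imp_increasing_open[of 0 1 G])
       (use G in \<open>auto simp: bump_def intro!: exI DERIV_isCont continuous_at_imp_continuous_on\<close>)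
  define c where "c = 1 / (G 1 - G 0)"
  have c: "c > 0" using G01 by (simp add: c_def)
  define \<Psi> where "\<Psi> x = c * (G x - G 0)" for x
  have bump_c: "bump [:c:] 0 x = c * bump 1 0 x" for x by (simp add: bump_def)
  have D: "(\<Psi> has_real_derivative bump [:c:] 0 x) (at x)" for x
    unfolding \<Psi>_def bump_c by (auto intro!: derivative_eq_intros G)
  have nonneg: "bump [:c:] 0 x \<ge> 0" for x using c by (simp add: bump_def)
  have mono: "\<Psi> x \<le> \<Psi> y" if "x \<le> y" for x y
    using DERIV_nonneg_imp_nondecreasing[OF that] D nonneg by blast
  have D0: "(\<Psi> has_real_derivative 0) (at z)" if "z \<le> 0 \<or> 1 \<le> z" for z
    using D[of z] that by (simp add: bump_def not_less split: if_splits)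
  have const: "\<Psi> x = \<Psi> y" if "x \<le> y" "y \<le> 0 \<or> 1 \<le> x" for x y
  proof (cases "x = y")
    case False
    show ?thesis
      by (rule DERIV_isconst_end[of x y \<Psi>, symmetric])
         (use that False D[THEN DERIV_isCont] in
           \<open>auto intro!: continuous_at_imp_continuous_on D0\<close>)
  qed simp
  have zero: "\<Psi> x = 0" if "x \<le> 0" for x
    using const[of x 0] that by (simp add: \<Psi>_def)
  have one: "\<Psi> x = 1" if "x \<ge> 1" for x
    using const[of 1 x] that G01 by (simp add: \<Psi>_def c_def)
  show ?thesis
  proof (rule that[of \<Psi> "bump [:c:] 0"])
    show "smooth \<Psi>" by (rule smooth_antiderivative[OF D smooth_bump])
    show "\<Psi> x \<in> {0..1}" for x
    proof -
      have "\<Psi> (min 0 x) \<le> \<Psi> x" "\<Psi> x \<le> \<Psi> (max 1 x)" by (auto intro!: mono)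
      then show ?thesis using zero[of "min 0 x"] one[of "max 1 x"] by simp
    qed
    show "continuous_on UNIV (bump [:c:] 0)"
      using cont by (simp add: continuous_at_imp_continuous_on)
    show "bump [:c:] 0 x = 0" if "x \<notin> {0..1}" for x
      using that by (auto simp: bump_def)
  qed (use D zero one nonneg in auto)
qed

subsection \<open>Functions with locally integrable weak derivative\<close>

lemma integrable_continuous_compact_support:
  fixes f :: "real \<Rightarrow> real"
  assumes "continuous_on UNIV f" "\<And>x. x \<notin> {a..b} \<Longrightarrow> f x = 0"
  shows "integrable lborel f"
proof -
  have "set_integrable lborel {a..b} f"
    using assms by (intro borel_integrable_atLeastAtMost') (auto intro: continuous_on_subset)
  moreover have "(\<lambda>x. indicator {a..b} x *\<^sub>R f x) = f"
    using assms by (auto simp: indicator_def fun_eq_iff)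
  ultimately show ?thesis by (simp add: set_integrable_def)
qed

lemma locally_integrable_Icc:
  "locally_integrable g \<Longrightarrow> set_integrable lborel {a..b} g"
  by (simp add: locally_integrable_def)

lemma locally_integrable_continuous:
  "continuous_on UNIV f \<Longrightarrow> locally_integrable f"
  unfolding locally_integrable_def set_integrable_def
  using borel_integrable_compact continuous_on_subset[OF _ subset_UNIV] by blast

lemma borel_measurable_locally_integrable:
  assumes "locally_integrable g"
  shows "g \<in> borel_measurable borel"
proof (rule borel_measurable_LIMSEQ_real)
  show "(\<lambda>x. indicator {- real n..real n} x * g x) \<in> borel_measurable borel" for n
    using borel_measurable_integrable[OF locally_integrable_Icc[OF assms, of "- real n" "real n", unfolded set_integrable_def]]
    by simp
  fix x :: real
  obtain N :: nat where "\<bar>x\<bar> \<le> real N" using real_arch_simple by blast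
  then have "\<forall>\<^sub>F n in sequentially. indicator {- real n..real n} x * g x = g x"
    by (auto simp: eventually_sequentially indicator_def intro!: exI[of _ N])
  then show "(\<lambda>n. indicator {- real n..real n} x * g x) \<longlonglongrightarrow> g x"
    by (rule tendsto_eventually)
qed

text \<open>Equivalently, \<open>u\<close> is locally absolutely continuous with derivative
  \<open>g\<close> almost everywhere; the integrated form avoids pointwise derivatives.\<close>

definition primitive :: "(real \<Rightarrow> real) \<Rightarrow> (real \<Rightarrow> real) \<Rightarrow> bool" where
  "primitive u g \<longleftrightarrow> continuous_on UNIV u \<and> locally_integrable g \<and>
     (\<forall>a b. a \<le> b \<longrightarrow> u b - u a = (LINT t:{a..b}|lborel. g t))"

text \<open>Substituting \<open>x = a + t / (n + 1)\<close> moves the scaling into the argument of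
  \<open>u\<close>. For \<open>t\<close> in the unit interval these arguments stay in
  \<open>{a..a + 1}\<close>, where \<open>u\<close> is bounded, so dominated convergence
  applies.\<close>

lemma approximate_identity:
  fixes u \<psi> :: "real \<Rightarrow> real"
  assumes u: "continuous_on UNIV u"
    and \<psi>: "continuous_on UNIV \<psi>" "\<And>x. x \<notin> {0..1} \<Longrightarrow> \<psi> x = 0" "(LINT x|lborel. \<psi> x) = 1"
  shows "(\<lambda>n. LINT x|lborel. u x * (real (Suc n) * \<psi> (real (Suc n) * (x - a)))) \<longlonglongrightarrow> u a"
proof -
  have eq: "(LINT x|lborel. u x * (real (Suc n) * \<psi> (real (Suc n) * (x - a))))
      = (LINT t|lborel. u (a + 1 / real (Suc n) * t) * \<psi> t)" for n
  proof -
    have "real (Suc n) * (a + 1 / real (Suc n) * t - a) = t" for t by (simp add: field_simps)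
    then show ?thesis
      by (subst lborel_integral_real_affine[where c = "1 / real (Suc n)" and t = a])
         (simp_all add: mult.left_commute[of _ "real (Suc n)"] del: of_nat_Suc)
  qed
  have "compact (u ` {a..a + 1})"
    by (intro compact_continuous_image continuous_on_subset[OF u]) auto
  then obtain M where M: "\<And>x. x \<in> {a..a + 1} \<Longrightarrow> \<bar>u x\<bar> \<le> M"
    using compact_imp_bounded bounded_iff by (metis imageI real_norm_def)
  have meas [measurable]: "u \<in> borel_measurable borel" "\<psi> \<in> borel_measurable borel"
    using u \<psi>(1) by (auto intro: borel_measurable_continuous_onI)
  have int: "integrable lborel \<psi>"
    by (rule integrable_continuous_compact_support[OF \<psi>(1,2)])
  have "(\<lambda>n. LINT t|lborel. u (a + 1 / real (Suc n) * t) * \<psi> t) \<longlonglongrightarrow> (LINT t|lborel. u a * \<psi> t)"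
  proof (rule integral_dominated_convergence)
    show "integrable lborel (\<lambda>t. M * \<bar>\<psi> t\<bar>)" using int by auto
    have "(\<lambda>n. a + 1 / real (Suc n) * t) \<longlonglongrightarrow> a + 0 * t" for t
      by (intro tendsto_intros LIMSEQ_Suc[OF lim_1_over_n])
    then have "(\<lambda>n. u (a + 1 / real (Suc n) * t)) \<longlonglongrightarrow> u a" for t
      using u by (intro isCont_tendsto_compose[of a u]) (auto simp: continuous_on_eq_continuous_at)
    then show "AE t in lborel. (\<lambda>n. u (a + 1 / real (Suc n) * t) * \<psi> t) \<longlonglongrightarrow> u a * \<psi> t"
      by (intro AE_I2 tendsto_intros)
    show "AE t in lborel. norm (u (a + 1 / real (Suc n) * t) * \<psi> t) \<le> M * \<bar>\<psi> t\<bar>" for n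
    proof (rule AE_I2)
      fix t :: real
      show "norm (u (a + 1 / real (Suc n) * t) * \<psi> t) \<le> M * \<bar>\<psi> t\<bar>"
      proof (cases "t \<in> {0..1}")
        case True
        then have "a + 1 / real (Suc n) * t \<in> {a..a + 1}" by (auto simp: field_simps)
        then show ?thesis using M by (auto simp: abs_mult intro!: mult_right_mono)
      qed (simp add: \<psi>(2))
    qed
  qed measurable
  then show ?thesis unfolding eq by (simp add: \<psi>(3))
qed

text \<open>Testing the weak derivative against smooth approximations of the indicator of an interval
  recovers the fundamental theorem of calculus.\<close>

lemma weak_derivative_imp_primitive:
  assumes wd: "has_weak_derivative u g" and u: "continuous_on UNIV u"
  shows "primitive u g"
proof -
  have g: "locally_integrable g" using wd by (simp add: has_weak_derivative_def)
  have [measurable]: "g \<in> borel_measurable borel"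
    by (rule borel_measurable_locally_integrable[OF g])
  obtain \<Psi> \<psi> :: "real \<Rightarrow> real" where \<Psi>: "smooth \<Psi>" "\<And>x. (\<Psi> has_real_derivative \<psi> x) (at x)"
    "\<And>x. x \<le> 0 \<Longrightarrow> \<Psi> x = 0" "\<And>x. x \<ge> 1 \<Longrightarrow> \<Psi> x = 1" "\<And>x. \<Psi> x \<in> {0..1}"
    and \<psi>: "continuous_on UNIV \<psi>" "\<And>x. x \<notin> {0..1} \<Longrightarrow> \<psi> x = 0"
    using smooth_step by metis
  have \<Psi>_cont: "continuous_on UNIV \<Psi>"
    using \<Psi>(2) by (auto intro!: continuous_at_imp_continuous_on DERIV_isCont)
  then have [measurable]: "\<Psi> \<in> borel_measurable borel" by (rule borel_measurable_continuous_onI)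
  have \<psi>1: "(LINT x|lborel. \<psi> x) = 1"
  proof -
    have "(LINT x|lborel. indicator {0..1} x *\<^sub>R \<psi> x) = \<Psi> 1 - \<Psi> 0"
      using \<Psi>(2) by (intro integral_FTC_atLeastAtMost continuous_on_subset[OF \<psi>(1)])
        (auto simp flip: has_real_derivative_iff_has_vector_derivative intro: DERIV_subset)
    moreover have "(\<lambda>x. indicator {0..1} x *\<^sub>R \<psi> x) = \<psi>"
      using \<psi>(2) by (auto simp: indicator_def fun_eq_iff)
    ultimately show ?thesis by (simp add: \<Psi>)
  qed
  have "u b - u a = (LINT t:{a..b}|lborel. g t)" if "a \<le> b" for a b
  proof -
    let ?N = "\<lambda>n. real (Suc n)"
    \<comment> \<open>A smooth plateau: it rises to the right of \<open>a\<close> and falls to the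
      right of \<open>b\<close>, each within length \<open>1 / (n + 1)\<close>. All supports lie in
      \<open>{a..b + 1}\<close>, which provides a common majorant.\<close>
    define \<phi> where "\<phi> n x = \<Psi> (?N n * (x - a)) - \<Psi> (?N n * (x - b))" for n x
    have \<phi>0: "\<phi> n x = 0" if "x \<notin> {a..b + 1}" for n x
    proof (cases "x < a")
      case True
      then have "?N n * (x - a) \<le> 0" "?N n * (x - b) \<le> 0"
        using \<open>a \<le> b\<close> by (auto simp: mult_le_0_iff)
      then show ?thesis by (simp add: \<phi>_def \<Psi>(3) del: of_nat_Suc)
    next
      case False
      then have "x - a > 1" "x - b > 1" using that \<open>a \<le> b\<close> by auto
      moreover have "?N n * (x - c) \<ge> 1 * 1" if "x - c > 1" for c
        using that by (intro mult_mono) auto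
      ultimately show ?thesis by (simp add: \<phi>_def \<Psi>(4) del: of_nat_Suc)
    qed
    have \<phi>1: "\<bar>\<phi> n x\<bar> \<le> 1" for n x
      using \<Psi>(5)[of "?N n * (x - a)"] \<Psi>(5)[of "?N n * (x - b)"] by (auto simp: \<phi>_def abs_le_iff)
    have D\<phi>: "(\<phi> n has_real_derivative ?N n * \<psi> (?N n * (x - a)) - ?N n * \<psi> (?N n * (x - b))) (at x)" for n x
    proof -
      have "((\<lambda>x. \<Psi> (?N n * (x - c))) has_real_derivative \<psi> (?N n * (x - c)) * ?N n) (at x)" for c
        by (rule DERIV_chain2[OF \<Psi>(2)]) (auto intro!: derivative_eq_intros)
      from DERIV_diff[OF this[of a] this[of b]] show ?thesis
        unfolding \<phi>_def[abs_def] by (simp add: mult.commute)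
    qed
    have test: "test_function (\<phi> n)" for n
      unfolding test_function_def
    proof (intro conjI allI exI[of _ "{a..b + 1}"])
      have "smooth (\<phi> n)"
        unfolding \<phi>_def by (intro smooth_diff smooth_affine \<Psi>(1))
      then show "(deriv ^^ k) (\<phi> n) field_differentiable at x" for k x
        by (rule smooth_imp_field_differentiable)
    qed (auto simp: \<phi>0)
    have int: "integrable lborel (\<lambda>x. u x * (?N n * \<psi> (?N n * (x - c))))" for n c
    proof (rule integrable_continuous_compact_support)
      show "continuous_on UNIV (\<lambda>x. u x * (?N n * \<psi> (?N n * (x - c))))"
        by (intro continuous_intros u continuous_on_compose2[OF \<psi>(1)]) auto
      fix x assume x: "x \<notin> {c..c + 1}"
      have "?N n * (x - c) \<notin> {0..1}"
      proof (cases "x < c")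
        case True
        then show ?thesis by (auto simp: mult_le_0_iff zero_le_mult_iff)
      next
        case False
        then have "?N n * (x - c) \<ge> 1 * (x - c)" using x by (intro mult_right_mono) auto
        moreover have "1 < x - c" using False x by auto
        ultimately have "?N n * (x - c) > 1" by (simp only: mult_1_left less_le_trans)
        then show ?thesis by (simp del: of_nat_Suc)
      qed
      then show "u x * (?N n * \<psi> (?N n * (x - c))) = 0" by (simp add: \<psi>(2))
    qed
    have "(LINT x|lborel. u x * deriv (\<phi> n) x)
        = (LINT x|lborel. u x * (?N n * \<psi> (?N n * (x - a)))) - (LINT x|lborel. u x * (?N n * \<psi> (?N n * (x - b))))" for n
      unfolding DERIV_imp_deriv[OF D\<phi>] right_diff_distrib[of "u _"]
      by (rule Bochner_Integration.integral_diff[OF int int])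
    moreover have "(\<lambda>n. (LINT x|lborel. u x * (?N n * \<psi> (?N n * (x - a))))
        - (LINT x|lborel. u x * (?N n * \<psi> (?N n * (x - b))))) \<longlonglongrightarrow> u a - u b"
      by (intro tendsto_diff approximate_identity[OF u \<psi> \<psi>1])
    moreover have "(LINT x|lborel. u x * deriv (\<phi> n) x) = - (LINT x|lborel. g x * \<phi> n x)" for n
      using wd test unfolding has_weak_derivative_def by blast
    ultimately have "(\<lambda>n. - (LINT x|lborel. g x * \<phi> n x)) \<longlonglongrightarrow> u a - u b" by simp
    moreover have "(\<lambda>n. LINT x|lborel. g x * \<phi> n x) \<longlonglongrightarrow> (LINT x|lborel. indicator {a..b} x *\<^sub>R g x)"
    proof (rule integral_dominated_convergence)
      show "integrable lborel (\<lambda>x. \<bar>indicator {a..b + 1} x *\<^sub>R g x\<bar>)"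
        using locally_integrable_Icc[OF g, of a "b + 1"]
        unfolding set_integrable_def by (rule integrable_abs)
      show "AE x in lborel. norm (g x * \<phi> n x) \<le> \<bar>indicator {a..b + 1} x *\<^sub>R g x\<bar>" for n
      proof (rule AE_I2)
        fix x
        show "norm (g x * \<phi> n x) \<le> \<bar>indicator {a..b + 1} x *\<^sub>R g x\<bar>"
          using \<phi>1[of n x] \<phi>0[of x n] by (auto simp: indicator_def abs_mult intro: mult_left_le)
      qed
      have lim1: "(\<lambda>n. \<Psi> (?N n * y)) \<longlonglongrightarrow> 1" if "y > 0" for y
      proof -
        obtain N :: nat where N: "1 / y \<le> real N" using real_arch_simple by blast
        have "\<forall>\<^sub>F n in sequentially. \<Psi> (?N n * y) = 1"
        proof (rule eventually_sequentiallyI[of N])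
          fix n assume "N \<le> n"
          then have "1 / y \<le> ?N n" using N by linarith
          then show "\<Psi> (?N n * y) = 1" using that by (intro \<Psi>(4)) (simp add: field_simps)
        qed
        then show ?thesis by (rule tendsto_eventually)
      qed
      have lim0: "(\<lambda>n. \<Psi> (?N n * y)) \<longlonglongrightarrow> 0" if "y \<le> 0" for y
      proof -
        have "\<Psi> (?N n * y) = 0" for n using that by (intro \<Psi>(3)) (auto simp: mult_le_0_iff)
        then show ?thesis by (simp del: of_nat_Suc)
      qed
      \<comment> \<open>At \<open>x = a\<close> the plateau has value 0 for every \<open>n\<close>,
        so the limit is the indicator of the interval without its left endpoint, which changes
        nothing almost everywhere.\<close>
      have "(\<lambda>n. \<phi> n x) \<longlonglongrightarrow> indicator {a..b} x" if xa: "x \<noteq> a" for x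
      proof -
        consider "x < a" | "a < x" "x \<le> b" | "b < x" using xa by linarith
        then show ?thesis
        proof cases
          case 1
          then show ?thesis unfolding \<phi>_def
            using tendsto_diff[OF lim0[of "x - a"] lim0[of "x - b"]] \<open>a \<le> b\<close> by simp
        next
          case 2
          then show ?thesis unfolding \<phi>_def
            using tendsto_diff[OF lim1[of "x - a"] lim0[of "x - b"]] by simp
        next
          case 3
          then show ?thesis unfolding \<phi>_def
            using tendsto_diff[OF lim1[of "x - a"] lim1[of "x - b"]] \<open>a \<le> b\<close> by simp
        qed
      qed
      then have "(\<lambda>n. g x * \<phi> n x) \<longlonglongrightarrow> indicator {a..b} x *\<^sub>R g x" if "x \<noteq> a" for x
        using tendsto_mult[OF tendsto_const[of "g x"], of "\<lambda>n. \<phi> n x" "indicator {a..b} x"] that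
        by (simp add: mult.commute)
      then show "AE x in lborel. (\<lambda>n. g x * \<phi> n x) \<longlonglongrightarrow> indicator {a..b} x *\<^sub>R g x"
        using AE_lborel_singleton[of a] by (auto elim!: eventually_mono)
    qed (simp_all add: \<phi>_def[abs_def])
    ultimately have "u a - u b = - (LINT x|lborel. indicator {a..b} x *\<^sub>R g x)"
      using tendsto_minus LIMSEQ_unique by blast
    then show ?thesis by (simp add: set_lebesgue_integral_def)
  qed
  then show ?thesis using u g by (simp add: primitive_def)
qed

text \<open>\<open>ennreal (h x)\<close> is the positive part and \<open>ennreal (- h x)\<close> the
  negative part. The measures with these densities agree on all half-lines, hence coincide, so the
  two parts agree almost everywhere; at each point one of them is 0.\<close>

lemma AE_zero_of_integral_Ioi_zero:
  fixes h :: "real \<Rightarrow> real"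
  assumes h: "integrable lborel h" and zero: "\<And>c. (LINT x:{c<..}|lborel. h x) = 0"
  shows "AE x in lborel. h x = 0"
proof -
  have [measurable]: "h \<in> borel_measurable borel" using borel_measurable_integrable[OF h] by simp
  have int: "integrable lborel (\<lambda>x. max 0 (f x) * indicator {c<..} x)"
    if "integrable lborel f" for f :: "real \<Rightarrow> real" and c
    using that by (intro integrable_real_mult_indicator) auto
  have em: "emeasure (density lborel (\<lambda>x. ennreal (f x))) {c<..}
      = ennreal (LINT x|lborel. max 0 (f x) * indicator {c<..} x)"
    if f: "integrable lborel f" for f :: "real \<Rightarrow> real" and c
  proof -
    have [measurable]: "f \<in> borel_measurable borel" using borel_measurable_integrable[OF f] by simp
    have "emeasure (density lborel (\<lambda>x. ennreal (f x))) {c<..}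
        = (\<integral>\<^sup>+x. ennreal (f x) * indicator {c<..} x \<partial>lborel)"
      by (rule emeasure_density) auto
    also have "\<dots> = (\<integral>\<^sup>+x. ennreal (max 0 (f x) * indicator {c<..} x) \<partial>lborel)"
      by (intro nn_integral_cong) (auto simp: indicator_def ennreal_max_0)
    also have "\<dots> = ennreal (LINT x|lborel. max 0 (f x) * indicator {c<..} x)"
      by (intro nn_integral_eq_integral int f) (auto simp: indicator_def)
    finally show ?thesis .
  qed
  have "density lborel (\<lambda>x. ennreal (h x)) = density lborel (\<lambda>x. ennreal (- h x))"
  proof (rule measure_eqI_lessThan)
    fix c
    show "emeasure (density lborel (\<lambda>x. ennreal (h x))) {c<..} < \<infinity>"
      unfolding em[OF h] by simp
    have "(LINT x|lborel. max 0 (h x) * indicator {c<..} x) - (LINT x|lborel. max 0 (- h x) * indicator {c<..} x)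
        = (LINT x|lborel. indicator {c<..} x *\<^sub>R h x)"
      by (subst Bochner_Integration.integral_diff[symmetric, OF int int])
        (use h in \<open>auto intro!: Bochner_Integration.integral_cong simp: max_def indicator_def\<close>)
    also have "\<dots> = 0" using zero[of c] by (simp add: set_lebesgue_integral_def)
    finally show "emeasure (density lborel (\<lambda>x. ennreal (h x))) {c<..}
        = emeasure (density lborel (\<lambda>x. ennreal (- h x))) {c<..}"
      using h by (simp add: em)
  qed simp_all
  moreover have "density lborel (\<lambda>x. ennreal (h x)) = density lborel (\<lambda>x. ennreal (- h x))
      \<longleftrightarrow> (AE x in lborel. ennreal (h x) = ennreal (- h x))"
    by (rule sigma_finite_measure.density_unique_iff[OF lborel.sigma_finite_measure_axioms]) auto
  ultimately have "AE x in lborel. ennreal (h x) = ennreal (- h x)" by simp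
  then show ?thesis
  proof (rule eventually_mono)
    fix x assume "ennreal (h x) = ennreal (- h x)"
    then show "h x = 0"
      by (metis ennreal_eq_0_iff ennreal_neg linorder_le_cases neg_0_le_iff_le neg_le_0_iff_le order_antisym)
  qed
qed

lemma primitive_unique:
  assumes "primitive u g" "primitive u g'"
  shows "AE x in lborel. g x = g' x"
proof -
  have loc: "locally_integrable g" "locally_integrable g'" using assms by (auto simp: primitive_def)
  note Icc = locally_integrable_Icc[OF loc(1)] locally_integrable_Icc[OF loc(2)]
  have eq: "(LINT t:{a..b}|lborel. g t) = (LINT t:{a..b}|lborel. g' t)" for a b
    using assms by (cases "a \<le> b") (auto simp: primitive_def set_lebesgue_integral_def)
  have "AE x in lborel. x \<in> {- real N..real N} \<longrightarrow> g x = g' x" for N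
  proof -
    \<comment> \<open>Truncation makes the difference globally integrable, and turns its integrals
      over half-lines into integrals over compact intervals, where the increments of
      \<open>u\<close> decide.\<close>
    define h where "h x = indicator {- real N..real N} x *\<^sub>R (g x - g' x)" for x
    have "integrable lborel h"
      using set_integral_diff(1)[OF Icc, of "- real N" "real N"]
      unfolding h_def[abs_def] set_integrable_def .
    moreover have "(LINT x:{c<..}|lborel. h x) = 0" for c
    proof -
      have "(LINT x:{c<..}|lborel. h x) = (LINT x:{max c (- real N)..real N}|lborel. g x - g' x)"
        unfolding set_lebesgue_integral_def h_def
        using AE_lborel_singleton[of c] borel_measurable_locally_integrable[OF loc(1)]
          borel_measurable_locally_integrable[OF loc(2)]
        by (intro integral_cong_AE) (auto simp: indicator_def elim!: eventually_mono)
      then show ?thesis using set_integral_diff(2)[OF Icc] eq by simp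
    qed
    ultimately have "AE x in lborel. h x = 0" by (rule AE_zero_of_integral_Ioi_zero)
    then show ?thesis by (rule eventually_mono) (auto simp: h_def)
  qed
  then have "AE x in lborel. \<forall>N. x \<in> {- real N..real N} \<longrightarrow> g x = g' x"
    unfolding AE_all_countable by blast
  then show ?thesis
  proof (rule eventually_mono)
    fix x :: real assume *: "\<forall>N. x \<in> {- real N..real N} \<longrightarrow> g x = g' x"
    obtain N :: nat where "\<bar>x\<bar> \<le> real N" using real_arch_simple by blast
    then show "g x = g' x" using *[rule_format, of N] by (simp add: abs_le_iff)
  qed
qed

text \<open>On \<open>{- R..R}\<close>, \<open>u x\<close> equals \<open>u R\<close> minus the
  integral of \<open>g\<close> from \<open>x\<close> to \<open>R\<close>; inserting this, Fubini on
  the triangle \<open>x \<le> y \<le> R\<close> gives the claim. The generality in \<open>M\<close>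
  and \<open>k\<close> permits two uses: Lebesgue measure weighted by the derivative of a test
  function, and the variations of \<open>\<rho>\<close> weighted by an indicator.\<close>

lemma primitive_integral_by_parts:
  fixes M :: "real measure"
  assumes M: "sigma_finite_measure M" "sets M = sets borel" and k: "integrable M k"
    and supp: "AE x in M. x \<notin> {- R..R} \<longrightarrow> k x = 0" and u: "primitive u g"
  shows "(LINT x|M. k x * u x) = u R * (LINT x|M. k x)
    - (LINT y:{- R..R}|lborel. g y * (LINT x:{..y}|M. k x))"
proof -
  interpret M: sigma_finite_measure M by fact
  interpret pair_sigma_finite M lborel ..
  note [measurable_cong] = M(2)
  have g: "locally_integrable g" using u by (simp add: primitive_def)
  have [measurable]: "g \<in> borel_measurable borel"
    by (rule borel_measurable_locally_integrable[OF g])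
  have [measurable]: "k \<in> borel_measurable borel"
    using borel_measurable_integrable[OF k] measurable_cong_sets[OF M(2) refl] by blast
  have [measurable]: "u \<in> borel_measurable borel"
    using u by (auto simp: primitive_def intro: borel_measurable_continuous_onI)
  define h where "h y = indicator {- R..R} y * g y" for y
  have h: "integrable lborel h"
    using locally_integrable_Icc[OF g, of "- R" R] unfolding h_def[abs_def] set_integrable_def by simp
  then have [measurable]: "h \<in> borel_measurable borel" using borel_measurable_integrable by fastforce
  define G where "G x y = k x * h y * (if x \<le> y then 1 else 0)" for x y
  have G_le: "\<bar>G x y\<bar> \<le> \<bar>k x\<bar> * \<bar>h y\<bar>" for x y by (simp add: G_def abs_mult)
  have G_meas [measurable]: "case_prod G \<in> borel_measurable (M \<Otimes>\<^sub>M lborel)"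
    unfolding G_def[abs_def] by measurable
  have G_int: "integrable lborel (G x)" for x
  proof (rule Bochner_Integration.integrable_bound)
    show "integrable lborel (\<lambda>y. \<bar>k x\<bar> * \<bar>h y\<bar>)" using h by auto
    show "G x \<in> borel_measurable lborel" unfolding G_def[abs_def] by measurable
  qed (use G_le in auto)
  have G: "integrable (M \<Otimes>\<^sub>M lborel) (case_prod G)"
  proof (rule Fubini_integrable)
    show "integrable M (\<lambda>x. LINT y|lborel. norm (case (x, y) of (x, y) \<Rightarrow> G x y))"
    proof (rule Bochner_Integration.integrable_bound)
      show "integrable M (\<lambda>x. \<bar>k x\<bar> * (LINT y|lborel. \<bar>h y\<bar>))" using k by auto
      show "AE x in M. norm (LINT y|lborel. norm (case (x, y) of (x, y) \<Rightarrow> G x y))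
          \<le> norm (\<bar>k x\<bar> * (LINT y|lborel. \<bar>h y\<bar>))"
      proof (rule AE_I2)
        fix x
        have "(LINT y|lborel. \<bar>G x y\<bar>) \<le> (LINT y|lborel. \<bar>k x\<bar> * \<bar>h y\<bar>)"
          using h G_int G_le by (intro integral_mono) auto
        moreover have "(LINT y|lborel. \<bar>G x y\<bar>) \<ge> 0" "(LINT y|lborel. \<bar>h y\<bar>) \<ge> 0" by simp_all
        ultimately show "norm (LINT y|lborel. norm (case (x, y) of (x, y) \<Rightarrow> G x y))
          \<le> norm (\<bar>k x\<bar> * (LINT y|lborel. \<bar>h y\<bar>))" by simp
      qed
    qed measurable
  qed (use G_int in auto)
  have 1: "k x * u x = u R * k x - (LINT y|lborel. G x y)" if "x \<notin> {- R..R} \<longrightarrow> k x = 0" for x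
  proof (cases "k x = 0")
    case False
    then have x: "x \<in> {- R..R}" using that by blast
    have "(LINT y|lborel. G x y) = (LINT y|lborel. k x * (indicator {x..R} y *\<^sub>R g y))"
      using x by (intro Bochner_Integration.integral_cong) (auto simp: G_def h_def indicator_def)
    also have "\<dots> = k x * (u R - u x)"
      using u x by (simp add: primitive_def set_lebesgue_integral_def)
    finally show ?thesis by (simp add: algebra_simps)
  qed (simp add: G_def)
  have "(LINT x|M. k x * u x) = (LINT x|M. u R * k x - (LINT y|lborel. G x y))"
    using supp by (intro integral_cong_AE) (auto intro: 1 elim!: eventually_mono)
  also have "\<dots> = u R * (LINT x|M. k x) - (LINT x|M. LINT y|lborel. G x y)"
    using k integrable_fst'[OF G] by simp
  also have "(LINT x|M. LINT y|lborel. G x y) = (LINT y|lborel. LINT x|M. G x y)"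
    by (rule Fubini_integral[OF G, symmetric])
  also have "\<dots> = (LINT y:{- R..R}|lborel. g y * (LINT x:{..y}|M. k x))"
    unfolding set_lebesgue_integral_def
  proof (intro Bochner_Integration.integral_cong refl)
    fix y
    have "(LINT x|M. G x y) = (LINT x|M. h y * (indicator {..y} x *\<^sub>R k x))"
      by (intro Bochner_Integration.integral_cong) (auto simp: G_def)
    then show "(LINT x|M. G x y) = indicator {- R..R} y *\<^sub>R (g y * (LINT x|M. indicator {..y} x *\<^sub>R k x))"
      by (simp add: h_def)
  qed
  finally show ?thesis .
qed

text \<open>Integration by parts with weight \<open>deriv \<phi>\<close>: its total integral is 0,
  which removes the boundary term, and its cumulative integral is \<open>\<phi>\<close>.\<close>

lemma primitive_imp_weak_derivative:
  assumes u: "primitive u g"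
  shows "has_weak_derivative u g"
proof -
  have g: "locally_integrable g" and loc: "locally_integrable u"
    using u locally_integrable_continuous by (auto simp: primitive_def)
  have "(LINT x|lborel. u x * deriv \<phi> x) = - (LINT x|lborel. g x * \<phi> x)" if \<phi>: "test_function \<phi>" for \<phi>
  proof -
    have diff: "(deriv ^^ k) \<phi> field_differentiable at x" for k x
      using \<phi> by (simp add: test_function_def)
    obtain K where K: "compact K" "\<And>x. x \<notin> K \<Longrightarrow> \<phi> x = 0"
      using \<phi> by (auto simp: test_function_def)
    obtain B where B: "\<And>x. x \<in> K \<Longrightarrow> \<bar>x\<bar> \<le> B"
      using K(1) compact_imp_bounded bounded_iff by (metis real_norm_def)
    \<comment> \<open>Strictly larger than the bound for the support, so that \<open>\<phi>\<close>
      vanishes at \<open>- R\<close> and \<open>R\<close> themselves.\<close>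
    define R where "R = \<bar>B\<bar> + 1"
    have \<phi>0: "\<phi> x = 0" if "\<bar>x\<bar> \<ge> R" for x
      using B[of x] that by (intro K(2)) (auto simp: R_def)
    have D: "(\<phi> has_real_derivative deriv \<phi> x) (at x)" for x
      using diff[of 0 x] by (simp add: field_differentiable_derivI)
    have cont: "continuous_on UNIV (deriv \<phi>)"
      using diff[of 1] by (auto intro!: continuous_at_imp_continuous_on field_differentiable_imp_continuous_at)
    have D0: "deriv \<phi> x = 0" if "x \<notin> {- R..R}" for x
    proof -
      have "(\<phi> has_real_derivative 0) (at x)"
        by (rule has_field_derivative_transform_within_open[of "\<lambda>_. 0" 0 x "- {- R..R}"])
          (use that \<phi>0 in \<open>auto simp: not_le\<close>)
      then show ?thesis by (rule DERIV_imp_deriv)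
    qed
    have int: "integrable lborel (deriv \<phi>)"
      by (rule integrable_continuous_compact_support[OF cont D0])
    have FTC: "(LINT x:{..y}|lborel. deriv \<phi> x) = \<phi> y" if "- R \<le> y" for y
    proof -
      have "(LINT x:{..y}|lborel. deriv \<phi> x) = (LINT x|lborel. indicator {- R..y} x *\<^sub>R deriv \<phi> x)"
        unfolding set_lebesgue_integral_def
        by (intro Bochner_Integration.integral_cong) (use D0 in \<open>auto simp: indicator_def\<close>)
      also have "\<dots> = \<phi> y - \<phi> (- R)"
        using that D by (intro integral_FTC_atLeastAtMost continuous_on_subset[OF cont])
          (auto simp flip: has_real_derivative_iff_has_vector_derivative intro: DERIV_subset)
      finally show ?thesis using \<phi>0[of "- R"] by (simp add: R_def)
    qed
    have zero: "(LINT x|lborel. deriv \<phi> x) = 0"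
    proof -
      have "(LINT x|lborel. deriv \<phi> x) = (LINT x:{..R}|lborel. deriv \<phi> x)"
        unfolding set_lebesgue_integral_def
        by (intro Bochner_Integration.integral_cong) (use D0 in \<open>auto simp: indicator_def\<close>)
      then show ?thesis using FTC[of R] \<phi>0[of R] by (simp add: R_def)
    qed
    have "(LINT x|lborel. deriv \<phi> x * u x) = u R * (LINT x|lborel. deriv \<phi> x)
        - (LINT y:{- R..R}|lborel. g y * (LINT x:{..y}|lborel. deriv \<phi> x))"
      by (rule primitive_integral_by_parts[OF lborel.sigma_finite_measure_axioms _ int _ u])
        (use D0 in auto)
    also have "(LINT y:{- R..R}|lborel. g y * (LINT x:{..y}|lborel. deriv \<phi> x)) = (LINT y|lborel. g y * \<phi> y)"
      unfolding set_lebesgue_integral_def[of _ "{- R..R}"]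
    proof (intro Bochner_Integration.integral_cong refl)
      fix y
      show "indicator {- R..R} y *\<^sub>R (g y * (LINT x:{..y}|lborel. deriv \<phi> x)) = g y * \<phi> y"
      proof (cases "y \<in> {- R..R}")
        case True
        then show ?thesis using FTC[of y] by simp
      next
        case False
        then have "\<bar>y\<bar> \<ge> R" by auto
        then show ?thesis using False \<phi>0 by simp
      qed
    qed
    finally show ?thesis by (simp add: zero mult.commute)
  qed
  then show ?thesis using g loc by (simp add: has_weak_derivative_def)
qed

text \<open>Makes the norm computable from any known derivative: the chosen
  \<open>weak_derivative u\<close> also has \<open>u\<close> as a primitive and therefore agrees
  with \<open>g\<close> almost everywhere.\<close>

lemma primitive_deriv_norm:
  assumes u: "primitive u g" and g: "integrable lborel (\<lambda>x. \<bar>g x\<bar> powr p)"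
  shows "u \<in> D1p p" "deriv_norm p u = (LINT x|lborel. \<bar>g x\<bar> powr p) powr (1 / p)"
proof -
  have wd: "has_weak_derivative u g" by (rule primitive_imp_weak_derivative[OF u])
  have cont: "continuous_on UNIV u" using u by (simp add: primitive_def)
  show "u \<in> D1p p"
    using wd cont g locally_integrable_continuous by (auto simp: D1p_def)
  have "has_weak_derivative u (weak_derivative u)"
    unfolding weak_derivative_def by (rule someI[where P = "has_weak_derivative u", OF wd])
  then have u': "primitive u (weak_derivative u)"
    using cont by (rule weak_derivative_imp_primitive)
  have [measurable]: "g \<in> borel_measurable borel" "weak_derivative u \<in> borel_measurable borel"
    using u u' by (auto simp: primitive_def intro: borel_measurable_locally_integrable)
  have "(LINT x|lborel. \<bar>weak_derivative u x\<bar> powr p) = (LINT x|lborel. \<bar>g x\<bar> powr p)"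
    using primitive_unique[OF u' u] by (intro integral_cong_AE) (auto elim!: eventually_mono)
  then show "deriv_norm p u = (LINT x|lborel. \<bar>g x\<bar> powr p) powr (1 / p)"
    by (simp add: deriv_norm_def)
qed

lemma D1p_primitive:
  assumes "u \<in> D1p p"
  obtains g where "primitive u g" "integrable lborel (\<lambda>x. \<bar>g x\<bar> powr p)"
    "deriv_norm p u = (LINT x|lborel. \<bar>g x\<bar> powr p) powr (1 / p)"
proof -
  obtain g where "has_weak_derivative u g" "continuous_on UNIV u" "integrable lborel (\<lambda>x. \<bar>g x\<bar> powr p)"
    using assms by (auto simp: D1p_def)
  then show ?thesis
    using that weak_derivative_imp_primitive primitive_deriv_norm(2) by blast
qed

section \<open>Affine changes of variable\<close>

lemma primitive_ident: "primitive (\<lambda>x. x) (\<lambda>_. 1)"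
  by (auto simp: primitive_def set_lebesgue_integral_def intro!: locally_integrable_continuous continuous_intros)

lemma primitive_affine:
  assumes u: "primitive u g" and c: "c \<noteq> 0"
  shows "primitive (\<lambda>x. u (c * x + d)) (\<lambda>x. c * g (c * x + d))"
  unfolding primitive_def
proof (intro conjI allI impI)
  have cont: "continuous_on UNIV u" and g: "locally_integrable g"
    and FTC: "\<And>a b. a \<le> b \<Longrightarrow> u b - u a = (LINT t:{a..b}|lborel. g t)"
    using u by (auto simp: primitive_def)
  show "continuous_on UNIV (\<lambda>x. u (c * x + d))"
    by (intro continuous_on_compose2[OF cont] continuous_intros) auto
  show "locally_integrable (\<lambda>x. c * g (c * x + d))"
    unfolding locally_integrable_def
  proof (intro allI impI)
    fix K :: "real set" assume K: "compact K"
    have "compact ((\<lambda>x. c * x + d) ` K)"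
      by (intro compact_continuous_image continuous_intros K)
    then have "integrable lborel (\<lambda>y. indicator ((\<lambda>x. c * x + d) ` K) y *\<^sub>R g y)"
      using g unfolding locally_integrable_def set_integrable_def by blast
    from lborel_integrable_real_affine[OF this c, of d]
    have "integrable lborel (\<lambda>x. c * (indicator ((\<lambda>x. c * x + d) ` K) (d + c * x) *\<^sub>R g (d + c * x)))"
      by (rule integrable_mult_right)
    moreover have "indicator ((\<lambda>x. c * x + d) ` K) (d + c * x) = (indicator K x :: real)" for x
      using c by (auto simp: indicator_def)
    ultimately show "set_integrable lborel K (\<lambda>x. c * g (c * x + d))"
      unfolding set_integrable_def by (simp add: add.commute mult.left_commute)
  qed
  fix a b :: real assume ab: "a \<le> b"
  show "u (c * b + d) - u (c * a + d) = (LINT t:{a..b}|lborel. c * g (c * t + d))"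
  \<comment> \<open>The substitution rule carries the factor \<open>\<bar>c\<bar>\<close>. For
    negative \<open>c\<close> the interval is also reversed, and the two changes of sign
    cancel.\<close>
  proof (cases "c > 0")
    case True
    have "u (c * b + d) - u (c * a + d) = (LINT y|lborel. indicator {c * a + d..c * b + d} y *\<^sub>R g y)"
      using FTC[of "c * a + d" "c * b + d"] True ab by (simp add: set_lebesgue_integral_def)
    also have "\<dots> = (LINT x|lborel. c * (indicator {c * a + d..c * b + d} (d + c * x) *\<^sub>R g (d + c * x)))"
      using True by (subst lborel_integral_real_affine[OF c, of _ d]) simp
    also have "\<dots> = (LINT t:{a..b}|lborel. c * g (c * t + d))"
      unfolding set_lebesgue_integral_def using True
      by (intro Bochner_Integration.integral_cong) (auto simp: indicator_def add.commute)
    finally show ?thesis .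
  next
    case False
    then have c0: "c < 0" using c by simp
    have "u (c * a + d) - u (c * b + d) = (LINT y|lborel. indicator {c * b + d..c * a + d} y *\<^sub>R g y)"
      using FTC[of "c * b + d" "c * a + d"] c0 ab by (simp add: set_lebesgue_integral_def)
    also have "\<dots> = - (LINT x|lborel. c * (indicator {c * b + d..c * a + d} (d + c * x) *\<^sub>R g (d + c * x)))"
      using c0 by (subst lborel_integral_real_affine[OF c, of _ d]) simp
    also have "(LINT x|lborel. c * (indicator {c * b + d..c * a + d} (d + c * x) *\<^sub>R g (d + c * x)))
        = (LINT t:{a..b}|lborel. c * g (c * t + d))"
      unfolding set_lebesgue_integral_def using c0
      by (intro Bochner_Integration.integral_cong) (auto simp: indicator_def add.commute)
    finally show ?thesis by simp
  qed
qed

text \<open>The exponent \<open>p - 1\<close> collects \<open>p\<close> from the inner derivative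
  and -1 from the substitution.\<close>

lemma Lp_affine:
  fixes g :: "real \<Rightarrow> real" and c d p :: real
  assumes g: "integrable lborel (\<lambda>x. \<bar>g x\<bar> powr p)" and c: "c \<noteq> 0"
  shows "integrable lborel (\<lambda>x. \<bar>c * g (c * x + d)\<bar> powr p)"
    and "(LINT x|lborel. \<bar>c * g (c * x + d)\<bar> powr p) = \<bar>c\<bar> powr (p - 1) * (LINT x|lborel. \<bar>g x\<bar> powr p)"
proof -
  have eq: "\<bar>c * g (c * x + d)\<bar> powr p = \<bar>c\<bar> powr p * \<bar>g (d + c * x)\<bar> powr p" for x
    by (simp add: abs_mult powr_mult add.commute)
  show "integrable lborel (\<lambda>x. \<bar>c * g (c * x + d)\<bar> powr p)"
    unfolding eq using lborel_integrable_real_affine[OF g c, of d] by simp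
  have "(LINT x|lborel. \<bar>g x\<bar> powr p) = \<bar>c\<bar> * (LINT x|lborel. \<bar>g (d + c * x)\<bar> powr p)"
    using lborel_integral_real_affine[OF c, of "\<lambda>x. \<bar>g x\<bar> powr p" d] by simp
  moreover have "\<bar>c\<bar> powr p = \<bar>c\<bar> powr (p - 1) * \<bar>c\<bar>"
    using c powr_add[of "\<bar>c\<bar>" "p - 1" 1] by simp
  ultimately show "(LINT x|lborel. \<bar>c * g (c * x + d)\<bar> powr p)
      = \<bar>c\<bar> powr (p - 1) * (LINT x|lborel. \<bar>g x\<bar> powr p)"
    unfolding eq by simp
qed

text \<open>Young's inequality is applied to \<open>f\<close> and \<open>g\<close> divided by their
  norms and then integrated. A vanishing norm is treated apart, as it rules out the division; one
  factor is then 0 almost everywhere.\<close>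

lemma Holder_inequality:
  fixes f g :: "'a \<Rightarrow> real" and p q :: real
  assumes pq: "p > 1" "q > 1" "1 / p + 1 / q = 1"
    and meas [measurable]: "f \<in> borel_measurable M" "g \<in> borel_measurable M"
    and f: "integrable M (\<lambda>x. \<bar>f x\<bar> powr p)" and g: "integrable M (\<lambda>x. \<bar>g x\<bar> powr q)"
  shows "\<bar>LINT x|M. f x * g x\<bar>
    \<le> (LINT x|M. \<bar>f x\<bar> powr p) powr (1 / p) * (LINT x|M. \<bar>g x\<bar> powr q) powr (1 / q)"
proof -
  define A where "A = (LINT x|M. \<bar>f x\<bar> powr p)"
  define B where "B = (LINT x|M. \<bar>g x\<bar> powr q)"
  have "A \<ge> 0" "B \<ge> 0" by (auto simp: A_def B_def)
  then consider "A = 0" | "B = 0" | "A > 0" "B > 0" by fastforce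
  then show ?thesis
  proof cases
    case 1
    then have "AE x in M. f x = 0"
      using integral_nonneg_eq_0_iff_AE[OF f] by (simp add: A_def)
    then have "(LINT x|M. f x * g x) = (LINT x|M. 0)"
      by (intro integral_cong_AE) (auto elim!: eventually_mono)
    then show ?thesis by simp
  next
    case 2
    then have "AE x in M. g x = 0"
      using integral_nonneg_eq_0_iff_AE[OF g] by (simp add: B_def)
    then have "(LINT x|M. f x * g x) = (LINT x|M. 0)"
      by (intro integral_cong_AE) (auto elim!: eventually_mono)
    then show ?thesis by simp
  next
    case 3
    define a where "a = A powr (1 / p)"
    define b where "b = B powr (1 / q)"
    have ab: "a > 0" "b > 0" "a powr p = A" "b powr q = B"
      using 3 pq by (auto simp: a_def b_def powr_powr)
    have le: "\<bar>f x * g x\<bar> \<le> a * b * (\<bar>f x\<bar> powr p / A / p + \<bar>g x\<bar> powr q / B / q)" for x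
    proof -
      have "(\<bar>f x\<bar> / a) * (\<bar>g x\<bar> / b) \<le> (\<bar>f x\<bar> / a) powr p / p + (\<bar>g x\<bar> / b) powr q / q"
        using ab by (intro Youngs_inequality[OF pq]) auto
      also have "\<dots> = \<bar>f x\<bar> powr p / A / p + \<bar>g x\<bar> powr q / B / q"
        using ab by (simp add: powr_divide)
      finally show ?thesis using ab by (simp add: field_simps abs_mult)
    qed
    have int: "integrable M (\<lambda>x. a * b * (\<bar>f x\<bar> powr p / A / p + \<bar>g x\<bar> powr q / B / q))"
      using f g by auto
    have "\<bar>LINT x|M. f x * g x\<bar> \<le> (LINT x|M. \<bar>f x * g x\<bar>)" by (rule integral_abs_bound)
    also have "\<dots> \<le> (LINT x|M. a * b * (\<bar>f x\<bar> powr p / A / p + \<bar>g x\<bar> powr q / B / q))"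
    \<comment> \<open>Only the majorant is known to be integrable. Its nonnegativity covers the
      default value 0 of a non-integrable left side.\<close>
    proof (rule integral_mono'[OF int])
      show "0 \<le> a * b * (\<bar>f x\<bar> powr p / A / p + \<bar>g x\<bar> powr q / B / q)" for x
        using order_trans[OF abs_ge_zero le] .
    qed (rule le)
    also have "\<dots> = a * b * (1 / p + 1 / q)"
      using f g 3 by (simp add: A_def[symmetric] B_def[symmetric])
    finally show ?thesis using pq by (simp add: a_def b_def A_def B_def)
  qed
qed

subsection \<open>The sharp Morrey inequality\<close>

lemma compactly_supported_Icc:
  assumes "compactly_supported \<rho>"
  obtains R where "\<forall>A\<in>sets borel. A \<inter> {- R..<R} = {} \<longrightarrow> \<rho> A = 0"
proof -
  obtain K where K: "compact K" "\<And>A. A \<in> sets borel \<Longrightarrow> A \<inter> K = {} \<Longrightarrow> \<rho> A = 0"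
    using assms by (auto simp: compactly_supported_def)
  obtain B where B: "\<And>x. x \<in> K \<Longrightarrow> \<bar>x\<bar> \<le> B"
    using K(1) compact_imp_bounded bounded_iff by (metis real_norm_def)
  have "K \<subseteq> {- (\<bar>B\<bar> + 1)..<\<bar>B\<bar> + 1}"
  proof
    fix x assume "x \<in> K"
    then show "x \<in> {- (\<bar>B\<bar> + 1)..<\<bar>B\<bar> + 1}" using B[of x] by auto
  qed
  then have "\<rho> A = 0" if "A \<in> sets borel" "A \<inter> {- (\<bar>B\<bar> + 1)..<\<bar>B\<bar> + 1} = {}" for A
    using that by (intro K(2)) auto
  then show ?thesis using that[of "\<bar>B\<bar> + 1"] by blast
qed

text \<open>Integration by parts with the indicator of \<open>{- R..R}\<close> as weight:
  \<open>M\<close> has no mass elsewhere, so the weight changes no integral. The boundary term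
  remains here and cancels only between the two variations; the first claim is what allows their
  integrals to be subtracted.\<close>

lemma integral_primitive_finite_measure:
  fixes M :: "real measure"
  assumes M: "finite_measure M" "sets M = sets borel" and null: "- {- R..R} \<in> null_sets M"
    and u: "primitive u g"
  shows "integrable lborel (\<lambda>y. indicator {- R..R} y *\<^sub>R (g y * measure M {..y}))"
    and "(LINT x|M. u x) = u R * measure M UNIV - (LINT y:{- R..R}|lborel. g y * measure M {..y})"
proof -
  interpret M: finite_measure M by fact
  have space: "space M = UNIV" using sets_eq_imp_space_eq[OF M(2)] by simp
  have g: "locally_integrable g" using u by (simp add: primitive_def)
  have [measurable]: "g \<in> borel_measurable borel"
    by (rule borel_measurable_locally_integrable[OF g])
  have [measurable]: "(\<lambda>y. measure M {..y}) \<in> borel_measurable borel"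
    by (intro borel_measurable_mono monoI M.finite_measure_mono) (auto simp: M(2))
  show "integrable lborel (\<lambda>y. indicator {- R..R} y *\<^sub>R (g y * measure M {..y}))"
  proof (rule Bochner_Integration.integrable_bound)
    show "integrable lborel (\<lambda>y. (indicator {- R..R} y *\<^sub>R g y) * measure M UNIV)"
      using locally_integrable_Icc[OF g, of "- R" R] unfolding set_integrable_def
      by (rule integrable_mult_left)
    show "AE y in lborel. norm (indicator {- R..R} y *\<^sub>R (g y * measure M {..y}))
        \<le> norm ((indicator {- R..R} y *\<^sub>R g y) * measure M UNIV)"
      using M.bounded_measure space
      by (intro AE_I2) (auto simp: abs_mult indicator_def intro!: mult_left_mono)
  qed measurable
  define k where "k x = (indicator {- R..R} x :: real)" for x
  have AE: "AE x in M. x \<in> {- R..R}"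
    using AE_not_in[OF null] by simp
  have k_int: "integrable M k"
    unfolding k_def[abs_def] by (intro integrable_indicator_iff[THEN iffD2]) (auto simp: M(2) less_top[symmetric])
  have "(LINT x|M. k x * u x) = u R * (LINT x|M. k x)
    - (LINT y:{- R..R}|lborel. g y * (LINT x:{..y}|M. k x))"
    by (rule primitive_integral_by_parts[OF M.sigma_finite_measure_axioms M(2) k_int _ u]) (simp add: k_def)
  moreover have "(LINT x|M. k x * u x) = (LINT x|M. u x)"
  proof (rule integral_cong_AE)
    have "u \<in> borel_measurable borel"
      using u by (auto simp: primitive_def intro: borel_measurable_continuous_onI)
    then show "u \<in> borel_measurable M" "(\<lambda>x. k x * u x) \<in> borel_measurable M"
      unfolding k_def by (auto simp: measurable_cong_sets[OF M(2) refl])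
    show "AE x in M. k x * u x = u x"
      using AE by (rule eventually_mono) (simp add: k_def)
  qed
  moreover have meas: "(LINT x:A|M. k x) = measure M A" if "A \<in> sets borel" for A
  proof -
    have "(LINT x:A|M. k x) = (LINT x|M. indicator A x)"
      unfolding set_lebesgue_integral_def
    proof (rule integral_cong_AE)
      show "AE x in M. indicat_real A x *\<^sub>R k x = indicator A x"
        using AE by (rule eventually_mono) (auto simp: k_def)
    qed (use that in \<open>auto simp: k_def[abs_def] measurable_cong_sets[OF M(2) refl]\<close>)
    then show ?thesis using that by (simp add: M(2) space)
  qed
  moreover have "(LINT x|M. k x) = measure M UNIV"
    using meas[of UNIV] by (simp add: set_lebesgue_integral_def)
  ultimately show "(LINT x|M. u x) = u R * measure M UNIV - (LINT y:{- R..R}|lborel. g y * measure M {..y})"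
    by simp
qed

text \<open>Left of the support this is the support condition; right of it, it is the vanishing
  total mass.\<close>

lemma cumulative_eq_0:
  assumes \<rho>: "signed_borel_measure \<rho>" "\<rho> UNIV = 0"
    and supp: "\<forall>A\<in>sets borel. A \<inter> {- R..<R} = {} \<longrightarrow> \<rho> A = 0"
    and y: "y \<notin> {- R..R}"
  shows "\<rho> {..y} = 0"
proof (cases "y < - R")
  case True
  then show ?thesis by (intro supp[rule_format]) auto
next
  case False
  then have "\<rho> {y<..} = 0" using y by (intro supp[rule_format]) auto
  moreover have "{..y} \<union> {y<..} = UNIV" "{..y} \<inter> {y<..} = {}" by auto
  ultimately show ?thesis
    using signed_borel_measure_Un[OF \<rho>(1), of "{..y}" "{y<..}"] \<rho>(2) by simp
qed

text \<open>Integration by parts against \<open>\<rho>\<close>: the boundary term vanishes since the total mass is 0.\<close>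

lemma signed_integral_primitive:
  assumes \<rho>: "signed_borel_measure \<rho>" "\<rho> UNIV = 0"
    and supp: "\<forall>A\<in>sets borel. A \<inter> {- R..<R} = {} \<longrightarrow> \<rho> A = 0"
    and u: "primitive u g"
  shows "signed_integral \<rho> u = - (LINT y|lborel. g y * \<rho> {..y})"
proof -
  let ?P = "upper_variation \<rho>" and ?N = "upper_variation (\<lambda>A. - \<rho> A)"
  note \<rho>' = signed_borel_measure_uminus[OF \<rho>(1)]
  have null: "- {- R..R} \<in> null_sets ?P" "- {- R..R} \<in> null_sets ?N"
  proof -
    have "\<rho> B = 0" if "B \<in> sets borel" "B \<subseteq> - {- R..R}" for B
      using that by (intro supp[rule_format]) auto
    then show "- {- R..R} \<in> null_sets ?P" "- {- R..R} \<in> null_sets ?N"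
      by (auto intro!: null_sets_upper_variation \<rho> \<rho>')
  qed
  note P = integral_primitive_finite_measure[OF finite_measure_upper_variation[OF \<rho>(1)]
      sets_upper_variation null(1) u]
  note N = integral_primitive_finite_measure[OF finite_measure_upper_variation[OF \<rho>']
      sets_upper_variation null(2) u]
  have "signed_integral \<rho> u = u R * (measure ?P UNIV - measure ?N UNIV)
      - ((LINT y:{- R..R}|lborel. g y * measure ?P {..y}) - (LINT y:{- R..R}|lborel. g y * measure ?N {..y}))"
    unfolding signed_integral_def P(2) N(2) by (simp add: algebra_simps)
  also have "measure ?P UNIV - measure ?N UNIV = 0"
    using Jordan_decomposition[OF \<rho>(1), of UNIV] \<rho>(2) by simp
  \<comment> \<open>Outside the window the distribution function is 0 as well, so the integral may
    be extended to the whole line and \<open>R\<close> disappears.\<close>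
  also have "(LINT y:{- R..R}|lborel. g y * measure ?P {..y}) - (LINT y:{- R..R}|lborel. g y * measure ?N {..y})
      = (LINT y|lborel. g y * \<rho> {..y})"
    unfolding set_lebesgue_integral_def
  proof (subst Bochner_Integration.integral_diff[OF P(1) N(1), symmetric],
      intro Bochner_Integration.integral_cong refl)
    fix y
    show "indicator {- R..R} y *\<^sub>R (g y * measure ?P {..y}) - indicator {- R..R} y *\<^sub>R (g y * measure ?N {..y})
        = g y * \<rho> {..y}"
      using Jordan_decomposition[OF \<rho>(1), of "{..y}"] cumulative_eq_0[OF \<rho> supp, of y]
      by (cases "y \<in> {- R..R}") (auto simp: right_diff_distrib)
  qed
  finally show ?thesis by simp
qed

text \<open>By the Jordan decomposition this function is a difference of two monotone ones.\<close>

lemma cumulative_bounded_measurable: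
  assumes \<rho>: "signed_borel_measure \<rho>"
  shows "(\<lambda>x. \<rho> {..x}) \<in> borel_measurable borel"
    and "\<exists>B. \<forall>x. \<bar>\<rho> {..x}\<bar> \<le> B"
proof -
  have meas: "(\<lambda>x. measure (upper_variation \<rho>) {..x}) \<in> borel_measurable borel"
    if "signed_borel_measure \<rho>" for \<rho>
  proof -
    interpret finite_measure "upper_variation \<rho>" by (rule finite_measure_upper_variation[OF that])
    show ?thesis by (intro borel_measurable_mono monoI finite_measure_mono) auto
  qed
  have "(\<lambda>x. \<rho> {..x}) = (\<lambda>x. measure (upper_variation \<rho>) {..x} - measure (upper_variation (\<lambda>A. - \<rho> A)) {..x})"
    by (intro ext Jordan_decomposition[OF \<rho>]) simp
  then show "(\<lambda>x. \<rho> {..x}) \<in> borel_measurable borel"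
    using meas[OF \<rho>] meas[OF signed_borel_measure_uminus[OF \<rho>]] by (simp add: borel_measurable_diff)
  obtain M M' where "\<And>B. B \<in> sets borel \<Longrightarrow> \<rho> B \<le> M" "\<And>B. B \<in> sets borel \<Longrightarrow> - \<rho> B \<le> M'"
    using signed_borel_measure_bounded[OF \<rho>]
      signed_borel_measure_bounded[OF signed_borel_measure_uminus[OF \<rho>]] by metis
  then have M: "\<rho> {..x} \<le> M" "- \<rho> {..x} \<le> M'" for x by simp_all
  have "\<bar>\<rho> {..x}\<bar> \<le> \<bar>M\<bar> + \<bar>M'\<bar>" for x using M[of x] by linarith
  then show "\<exists>B. \<forall>x. \<bar>\<rho> {..x}\<bar> \<le> B" by blast
qed

lemma integrable_bounded_support:
  fixes f :: "real \<Rightarrow> real"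
  assumes "f \<in> borel_measurable borel" "\<And>x. \<bar>f x\<bar> \<le> B" "\<And>x. x \<notin> {- R..R} \<Longrightarrow> f x = 0"
  shows "integrable lborel f"
proof (rule integrableI_bounded_set[where A = "{- R..R}" and B = B])
  show "emeasure lborel {- R..R} < \<infinity>" by (simp add: emeasure_lborel_Icc_eq)
qed (use assms in auto)

text \<open>Boundedness makes the integral Lipschitz in its upper limit, which supplies the
  continuity demanded by \<open>primitive\<close>.\<close>

lemma primitive_of_bounded:
  fixes H :: "real \<Rightarrow> real"
  assumes H: "integrable lborel H" "\<And>x. \<bar>H x\<bar> \<le> B"
  shows "primitive (\<lambda>x. LINT y:{..x}|lborel. H y) H"
proof -
  let ?v = "\<lambda>x. LINT y:{..x}|lborel. H y"
  have [measurable]: "H \<in> borel_measurable borel" using borel_measurable_integrable[OF H(1)] by simp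
  have si: "set_integrable lborel A H" if "A \<in> sets borel" for A
    unfolding set_integrable_def using integrable_mult_indicator[OF _ H(1), of A] that by simp
  have FTC: "?v b - ?v a = (LINT t:{a..b}|lborel. H t)" if "a \<le> b" for a b
  proof -
    have "?v b - ?v a = (LINT x|lborel. indicator {..b} x *\<^sub>R H x - indicator {..a} x *\<^sub>R H x)"
      unfolding set_lebesgue_integral_def
      using si[of "{..b}"] si[of "{..a}"] unfolding set_integrable_def
      by (intro Bochner_Integration.integral_diff[symmetric]) auto
    also have "\<dots> = (LINT t:{a..b}|lborel. H t)"
      unfolding set_lebesgue_integral_def
    proof (rule integral_cong_AE)
      show "AE x in lborel. indicator {..b} x *\<^sub>R H x - indicator {..a} x *\<^sub>R H x = indicator {a..b} x *\<^sub>R H x"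
        using AE_lborel_singleton[of a] that by (auto simp: indicator_def elim!: eventually_mono)
    qed measurable
    finally show ?thesis .
  qed
  have B: "B \<ge> 0" using order_trans[OF abs_ge_zero H(2)] .
  have lip: "\<bar>?v b - ?v a\<bar> \<le> B * \<bar>b - a\<bar>" if "a \<le> b" for a b
  proof -
    have "\<bar>LINT t:{a..b}|lborel. H t\<bar> \<le> (LINT t|lborel. \<bar>indicator {a..b} t *\<^sub>R H t\<bar>)"
      unfolding set_lebesgue_integral_def by (rule integral_abs_bound)
    also have "\<dots> \<le> (LINT t|lborel. indicator {a..b} t * B)"
    proof (rule integral_mono)
      show "integrable lborel (\<lambda>t. \<bar>indicator {a..b} t *\<^sub>R H t\<bar>)"
        using si[of "{a..b}"] unfolding set_integrable_def by auto
      show "integrable lborel (\<lambda>t. indicator {a..b} t * B)"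
        by (intro integrable_mult_left integrable_real_indicator) (auto simp: emeasure_lborel_Icc_eq)
    qed (use H(2) in \<open>auto simp: indicator_def\<close>)
    also have "\<dots> = B * \<bar>b - a\<bar>" using that by simp
    finally show ?thesis using FTC[OF that] by simp
  qed
  have "continuous_on UNIV ?v"
  proof (rule lipschitz_on_continuous_on[of B], rule lipschitz_onI)
    fix x y :: real
    show "dist (?v x) (?v y) \<le> B * dist x y"
      using lip[of x y] lip[of y x] by (cases "x \<le> y") (auto simp: dist_real_def abs_minus_commute)
  qed (rule B)
  moreover have "locally_integrable H"
    unfolding locally_integrable_def using si by (auto simp: borel_compact)
  ultimately show ?thesis using FTC by (simp add: primitive_def)
qed

text \<open>The conjunct on \<open>smallest_morrey_constant\<close> certifies that the description
  defining \<open>C_star\<close> denotes an actual minimum.\<close>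

theorem proposition6p1:
  fixes p q :: real and \<rho> :: "real set \<Rightarrow> real" and F v :: "real \<Rightarrow> real"
  assumes "1 < p" and "1 / p + 1 / q = 1"
    and "admissible \<rho>"
    and "\<And>x. F x = \<rho> {..x}"
    and "\<And>x. v x = - (LINT y:{..x}|lborel. \<bar>F y\<bar> powr (q - 2) * F y)"
  shows "extremal p \<rho> v \<and>
         morrey_seminorm p \<rho> v =
           ereal (\<bar>signed_integral \<rho> v\<bar> / \<bar>signed_integral \<rho> (\<lambda>y. y)\<bar> powr (1 - 1 / p)) \<and>
         smallest_morrey_constant p \<rho> (C_star p \<rho>) \<and>
         C_star p \<rho> = (LINT y|lborel. \<bar>F y\<bar> powr q) powr (1 / q)
                        / \<bar>signed_integral \<rho> (\<lambda>y. y)\<bar> powr (1 / q)"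
proof -
  note F = assms(4)
  have \<rho>: "signed_borel_measure \<rho>" "\<rho> UNIV = 0" and "compactly_supported \<rho>"
    and m_neq: "signed_integral \<rho> (\<lambda>y. y) \<noteq> 0"
    using assms(3) by (auto simp: admissible_def)
  then obtain R where supp: "\<forall>A\<in>sets borel. A \<inter> {- R..<R} = {} \<longrightarrow> \<rho> A = 0"
    using compactly_supported_Icc by metis
  have q_inv: "1 / q = 1 - 1 / p" using assms(2) by simp
  have "1 / p < 1" "1 / p > 0" using assms(1) by auto
  then have q_inv_less: "0 < 1 / q" "1 / q < 1" using q_inv by auto
  then have "q > 0" by simp
  then have q: "q > 1" using q_inv_less by (simp add: field_simps)
  have pq: "(q - 1) * p = q" using assms(1,2) q by (simp add: field_simps)

  have F_meas [measurable]: "F \<in> borel_measurable borel"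
    using cumulative_bounded_measurable(1)[OF \<rho>(1)] by (simp add: F[abs_def])
  obtain B where B: "\<And>x. \<bar>F x\<bar> \<le> B"
    using cumulative_bounded_measurable(2)[OF \<rho>(1)] by (auto simp: F)
  have F0: "F x = 0" if "x \<notin> {- R..R}" for x
    unfolding F by (rule cumulative_eq_0[OF \<rho> supp that])
  note by_parts = signed_integral_primitive[OF \<rho> supp, folded F]

  define I where "I = (LINT y|lborel. \<bar>F y\<bar> powr q)"
  define m where "m = signed_integral \<rho> (\<lambda>y. y)"
  define C where "C = I powr (1 / q) / \<bar>m\<bar> powr (1 / q)"
  have F_q: "integrable lborel (\<lambda>x. \<bar>F x\<bar> powr q)"
  proof (rule integrable_bounded_support[where B = "B powr q"])
    show "\<bar>\<bar>F x\<bar> powr q\<bar> \<le> B powr q" for x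
      using B[of x] q by (simp add: powr_mono2)
  qed (use F0 in auto)
  have m: "m \<noteq> 0" "m = - (LINT y|lborel. F y)"
    using m_neq by_parts[OF primitive_ident] by (simp_all add: m_def)
  \<comment> \<open>If \<open>I\<close> were 0, then \<open>F\<close> would vanish almost everywhere
    and so would the first moment \<open>m\<close>.\<close>
  have I: "I > 0"
  proof -
    have "I \<noteq> 0"
    proof
      assume "I = 0"
      then have "AE x in lborel. F x = 0"
        using integral_nonneg_eq_0_iff_AE[OF F_q] by (simp add: I_def)
      then have "(LINT x|lborel. F x) = 0" by (rule integral_eq_zero_AE)
      with m show False by simp
    qed
    then show ?thesis by (simp add: I_def less_le)
  qed

  have upper: "\<bar>signed_integral (push_forward S \<rho>) u\<bar>
      / \<bar>signed_integral (push_forward S \<rho>) (\<lambda>x. x)\<bar> powr (1 - 1 / p) \<le> C * deriv_norm p u"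
    if u: "u \<in> D1p p" and S: "S \<in> similarities" for u S
  proof -
    \<comment> \<open>The reflection is absorbed into the sign of \<open>c\<close>.\<close>
    obtain c d where S_eq: "S = (\<lambda>y. c * y + d)" and c: "c \<noteq> 0"
      using S unfolding similarities_def
      by (auto simp: mult.assoc[symmetric] mult_neg_pos intro: that)
    obtain g where g: "primitive u g" "integrable lborel (\<lambda>x. \<bar>g x\<bar> powr p)"
      "deriv_norm p u = (LINT x|lborel. \<bar>g x\<bar> powr p) powr (1 / p)"
      using D1p_primitive[OF u] by blast
    have push: "signed_integral (push_forward S \<rho>) f = signed_integral \<rho> (\<lambda>x. f (c * x + d))"
      if "f \<in> borel_measurable borel" for f
      unfolding S_eq using c
      by (intro signed_integral_push_forward[OF \<rho>(1), where T = "\<lambda>y. (y - d) / c"] that) auto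
    have den: "signed_integral (push_forward S \<rho>) (\<lambda>x. x) = c * m"
      using push[of "\<lambda>x. x"] by_parts[OF primitive_affine[OF primitive_ident c, of d]]
      by (simp add: m(2))
    have "u \<in> borel_measurable borel"
      using g(1) by (auto simp: primitive_def intro: borel_measurable_continuous_onI)
    then have "signed_integral (push_forward S \<rho>) u = - (LINT x|lborel. (c * g (c * x + d)) * F x)"
      using push by_parts[OF primitive_affine[OF g(1) c, of d]] by simp
    also have "\<bar>\<dots>\<bar> \<le> (LINT x|lborel. \<bar>c * g (c * x + d)\<bar> powr p) powr (1 / p) * I powr (1 / q)"
      unfolding I_def abs_minus_cancel
    proof (rule Holder_inequality[OF assms(1) q assms(2)])
      have "g \<in> borel_measurable borel"
        using g(1) by (auto simp: primitive_def intro: borel_measurable_locally_integrable)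
      then show "(\<lambda>x. c * g (c * x + d)) \<in> borel_measurable lborel" by simp
    qed (use Lp_affine(1)[OF g(2) c] F_q in auto)
    also have "\<dots> = \<bar>c\<bar> powr (1 - 1 / p) * deriv_norm p u * I powr (1 / q)"
      using assms(1) unfolding Lp_affine(2)[OF g(2) c] g(3)
      by (simp add: powr_mult powr_powr diff_divide_distrib)
    finally have "\<bar>signed_integral (push_forward S \<rho>) u\<bar> / \<bar>c * m\<bar> powr (1 - 1 / p)
        \<le> \<bar>c\<bar> powr (1 - 1 / p) * deriv_norm p u * I powr (1 / q) / \<bar>c * m\<bar> powr (1 - 1 / p)"
      by (intro divide_right_mono) auto
    also have "\<dots> = C * deriv_norm p u"
      using c m(1) by (simp add: C_def q_inv abs_mult powr_mult)
    finally show ?thesis by (simp add: den)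
  qed

  \<comment> \<open>Equality in the Hoelder inequality requires \<open>\<bar>H\<bar> powr p\<close>
    proportional to \<open>\<bar>F\<bar> powr q\<close> and \<open>H * F\<close> of constant sign.
    The exponent \<open>q - 2\<close> achieves the former since \<open>(q - 1) * p = q\<close>; the
    minus sign cancels the one from integration by parts.\<close>
  define H where "H x = - (\<bar>F x\<bar> powr (q - 2) * F x)" for x
  have H_abs: "\<bar>H x\<bar> = \<bar>F x\<bar> powr (q - 1)" for x
  \<comment> \<open>Exponents add only for a nonzero base. Where \<open>F\<close> vanishes both
    sides are 0, in agreement with the convention for \<open>q < 2\<close>.\<close>
  proof (cases "F x = 0")
    case False
    then have "\<bar>F x\<bar> powr (q - 1) = \<bar>F x\<bar> powr (q - 2) * \<bar>F x\<bar>"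
      using powr_add[of "\<bar>F x\<bar>" "q - 2" 1] by simp
    then show ?thesis by (simp add: H_def abs_mult)
  qed (simp add: H_def)
  have H_p: "\<bar>H x\<bar> powr p = \<bar>F x\<bar> powr q" for x
    using pq by (simp add: H_abs powr_powr)
  have HF: "H x * F x = - (\<bar>F x\<bar> powr q)" for x
  proof (cases "F x = 0")
    case False
    then have "\<bar>F x\<bar> powr q = \<bar>F x\<bar> powr (q - 2) * \<bar>F x\<bar>\<^sup>2"
      using powr_add[of "\<bar>F x\<bar>" "q - 2" 2] by simp
    then show ?thesis by (simp add: H_def power2_eq_square)
  qed simp
  have v: "primitive v H"
  proof -
    have H_le: "\<bar>H x\<bar> \<le> B powr (q - 1)" for x
      using B[of x] q by (simp add: H_abs powr_mono2)
    have "integrable lborel H"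
      by (rule integrable_bounded_support[OF _ H_le]) (use F0 in \<open>auto simp: H_def[abs_def]\<close>)
    moreover have "v = (\<lambda>x. LINT y:{..x}|lborel. H y)"
      using assms(5) by (simp add: fun_eq_iff H_def set_lebesgue_integral_def)
    ultimately show ?thesis using primitive_of_bounded[OF _ H_le] by simp
  qed
  have v_norm: "v \<in> D1p p" "deriv_norm p v = I powr (1 / p)"
    using primitive_deriv_norm[OF v, of p] F_q by (simp_all add: H_p I_def)
  have v_int: "signed_integral \<rho> v = I"
    using by_parts[OF v] by (simp add: HF I_def)
  have I_split: "I = I powr (1 / q) * I powr (1 / p)"
    using I assms(2) by (simp add: powr_add[symmetric] add.commute)
  \<comment> \<open>The numerator \<open>I\<close> splits into \<open>I powr (1 / q)\<close>, which
    belongs to \<open>C\<close>, and \<open>I powr (1 / p)\<close>, the norm of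
    \<open>v\<close>.\<close>
  have v_ratio: "\<bar>signed_integral \<rho> v\<bar> / \<bar>m\<bar> powr (1 - 1 / p) = C * deriv_norm p v"
    using I I_split by (simp add: v_int v_norm C_def q_inv)

  have id: "(\<lambda>y. y) \<in> similarities"
    unfolding similarities_def by (rule CollectI, intro exI[of _ 1] exI[of _ 0]) simp
  have v_lower: "ereal (C * deriv_norm p v) \<le> morrey_seminorm p \<rho> v"
    unfolding morrey_seminorm_def v_ratio[symmetric] m_def
    by (rule SUP_upper2[OF imageI[OF id]]) (simp add: push_forward_def)
  have ineq: "morrey_inequality p \<rho> C"
    unfolding morrey_inequality_def morrey_seminorm_def using upper by (auto intro!: SUP_least)
  then have v_sup: "morrey_seminorm p \<rho> v = ereal (C * deriv_norm p v)"
    using v_lower v_norm(1) by (auto simp: morrey_inequality_def intro: antisym)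
  have C: "smallest_morrey_constant p \<rho> C"
    unfolding smallest_morrey_constant_def
  proof (intro conjI allI impI ineq)
    \<comment> \<open>Testing with \<open>v\<close> suffices: its norm is the positive number
      \<open>I powr (1 / p)\<close> and can be cancelled.\<close>
    fix C' assume "morrey_inequality p \<rho> C'"
    then have "C * deriv_norm p v \<le> C' * deriv_norm p v"
      using v_sup v_norm(1) unfolding morrey_inequality_def by fastforce
    then show "C \<le> C'" using I by (simp add: v_norm)
  qed
  have "C_star p \<rho> = C"
    unfolding C_star_def
  proof (rule the_equality)
    show "C' = C" if "smallest_morrey_constant p \<rho> C'" for C'
      using C that unfolding smallest_morrey_constant_def by (meson antisym)
  qed (rule C)
  then show ?thesis
    using C v_norm(1) v_sup v_ratio by (simp add: extremal_def C_def I_def m_def)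
qed

end
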